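(* Let $(U,\mathcal{L})$ be a complex of uniform oriented matroids (CUOM) and let $G$ be its tope graph, of VC-dimension $d$. Then $G$ can be completed to an ample partial cube $\mathrm{amp}(G)$ of VC-dimension $d$; that is, there exists an ample family $\mathcal{S}\subseteq\{-1,+1\}^U$ of VC-dimension $d$ that contains all topes of $\mathcal{L}$.
   Context: $U$ is a finite set. A system of sign vectors is a pair $(U,\mathcal{L})$ with $\mathcal{L}\subseteq\{-1,0,+1\}^U$; its elements are called covectors. For a sign vector $X$: the support is $\underline{X}=\{e\in U:X_e\ne 0\}$ and the zero set is $X^0=U\setminus\underline{X}$. For sign vectors $X,Y$: the separator is $S(X,Y)=\{e\in U: X_eY_e=-1\}$; the composition $X\circ Y$ is given by $(X\circ Y)_e=X_e$ if $X_e\neq 0$ and $(X\circ Y)_e=Y_e$ if $X_e=0$; and $\le$ is the product order on $\{-1,0,+1\}^U$ induced by $0\le -1$, $0\le +1$. A complex of oriented matroids (COM) is a system of sign vectors $(U,\mathcal{L})$ satisfying: (SE) for all $X,Y\in\mathcal{L}$ and each $e\in S(X,Y)$ there is $Z\in\mathcal{L}$ with $Z_e=0$ and $Z_f=(X\circ Y)_f$ for all $f\in U\setminus S(X,Y)$; (FS) $X\circ(-Y)\in\mathcal{L}$ for all $X,Y\in\mathcal{L}$. Oriented matroids (OMs) are exactly the COMs containing the zero vector. Throughout, all systems are assumed simple: for each $e\in U$, $\{X_e:X\in\mathcal{L}\}=\{-1,0,+1\}$, and for each pair $e\neq f$ in $U$ there exist $X,Y\in\mathcal{L}$ with $\{X_eX_f,Y_eY_f\}=\{+1,-1\}$.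 The cocircuits of an OM are its minimal nonzero covectors. The rank of an OM is the length of the maximal chains of the poset $(\mathcal{L}\cup\{\hat 1\},\le)$ ($\hat 1$ an added maximum; length is number of elements minus one) minus one. A uniform oriented matroid (UOM) of rank $r$ on a set of size $m$ is an OM whose set of cocircuits consists of exactly two opposite signings of each subset of size $m-r+1$. The face of a covector $X\in\mathcal{L}$ is $F(X)=\{X\circ Y:Y\in\mathcal{L}\}$. Each face of a COM is an OM, after restricting its sign vectors to the coordinates in $X^0$ (on $\underline{X}$ they are constant). A facet of $\mathcal{L}$ is an inclusion-maximal face. A complex of uniform oriented matroids (CUOM) is a COM in which each facet is a UOM (on $X^0$). The topes of $\mathcal{L}$ are the covectors in $\{-1,+1\}^U$; the tope graph is the subgraph of the hypercube $Q(U)$ on $\{-1,+1\}^U$ (edges: vectors differing in exactly one coordinate) induced by the topes. Vectors in $\{-1,+1\}^U$ are identified with subsets of $U$ (the coordinates equal to $+1$), so a set of vertices of the hypercube is a family $\mathcal{S}\subseteq 2^U$. A set $X\subseteq U$ is shattered by $\mathcal{S}$ if for every $Y\subseteq X$ there is $S\in\mathcal{S}$ with $S\cap X=Y$. The VC-dimension of $\mathcal{S}$ (and of the subgraph of $Q(U)$ induced by $\mathcal{S}$) is the largest size of a shattered set. $X$ is strongly shattered by $\mathcal{S}$ if there is $Y\subseteq U\setminus X$ with $\{Y\cup X':X'\subseteq X\}\subseteq\mathcal{S}$. $\mathcal{S}$ is ample if every set shattered by $\mathcal{S}$ is strongly shattered by $\mathcal{S}$ (equivalently, $|\mathcal{S}|$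 equals the number of sets shattered by $\mathcal{S}$). The subgraph of $Q(U)$ induced by a (nonempty) ample family is an isometric subgraph of $Q(U)$ and is called an ample partial cube. *)

theory Defs
  imports Complex_Main
begin

text \<open>
  A sign vector on \<open>U\<close> is a function with values in \<open>{-1, 0, 1}\<close> on \<open>U\<close> that is extended by
  \<open>0\<close> outside \<open>U\<close>, so that each vector has exactly one representative and a restriction to
  a smaller ground set is again a total function. The negative \<open>- X\<close> is the pointwise one.
\<close>

type_synonym 'a svec = "'a \<Rightarrow> int"

definition sign_vectors :: "'a set \<Rightarrow> 'a svec set" where
  "sign_vectors U = {X. (\<forall>e\<in>U. X e \<in> {-1, 0, 1}) \<and> (\<forall>e. e \<notin> U \<longrightarrow> X e = 0)}"

definition supp :: "'a set \<Rightarrow> 'a svec \<Rightarrow> 'a set" where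
  "supp U X = {e \<in> U. X e \<noteq> 0}"

definition zero_set :: "'a set \<Rightarrow> 'a svec \<Rightarrow> 'a set" where
  "zero_set U X = U - supp U X"

definition separator :: "'a set \<Rightarrow> 'a svec \<Rightarrow> 'a svec \<Rightarrow> 'a set" where
  "separator U X Y = {e \<in> U. X e * Y e = -1}"

definition scomp :: "'a svec \<Rightarrow> 'a svec \<Rightarrow> 'a svec" where
  "scomp X Y = (\<lambda>e. if X e \<noteq> 0 then X e else Y e)"

text \<open>The product of the order on the signs in which \<open>0\<close> lies below \<open>-1\<close> and below \<open>1\<close>.\<close>

definition sle :: "'a svec \<Rightarrow> 'a svec \<Rightarrow> bool" where
  "sle X Y \<longleftrightarrow> (\<forall>e. X e = 0 \<or> X e = Y e)"

definition com :: "'a set \<Rightarrow> 'a svec set \<Rightarrow> bool" where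
  "com U L \<longleftrightarrow> L \<subseteq> sign_vectors U \<and>
     (\<forall>X\<in>L. \<forall>Y\<in>L. \<forall>e\<in>separator U X Y.
        \<exists>Z\<in>L. Z e = 0 \<and> (\<forall>f\<in>U - separator U X Y. Z f = scomp X Y f)) \<and>
     (\<forall>X\<in>L. \<forall>Y\<in>L. scomp X (- Y) \<in> L)"

definition om :: "'a set \<Rightarrow> 'a svec set \<Rightarrow> bool" where
  "om U L \<longleftrightarrow> com U L \<and> (\<lambda>_. 0) \<in> L"

definition simple_system :: "'a set \<Rightarrow> 'a svec set \<Rightarrow> bool" where
  "simple_system U L \<longleftrightarrow>
     (\<forall>e\<in>U. {X e | X. X \<in> L} = {-1, 0, 1}) \<and>
     (\<forall>e\<in>U. \<forall>f\<in>U. e \<noteq> f \<longrightarrow> (\<exists>X\<in>L. \<exists>Y\<in>L. {X e * X f, Y e * Y f} = {1, -1}))"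

definition cocircuits :: "'a svec set \<Rightarrow> 'a svec set" where
  "cocircuits L = {X \<in> L. X \<noteq> (\<lambda>_. 0) \<and>
     (\<forall>Y\<in>L. Y \<noteq> (\<lambda>_. 0) \<and> sle Y X \<longrightarrow> Y = X)}"

text \<open>The order on covectors with an added maximum, which is represented by \<open>None\<close>.\<close>

fun hat_le :: "'a svec option \<Rightarrow> 'a svec option \<Rightarrow> bool" where
  "hat_le _ None \<longleftrightarrow> True"
| "hat_le None (Some _) \<longleftrightarrow> False"
| "hat_le (Some X) (Some Y) \<longleftrightarrow> sle X Y"

text \<open>
  The first subtraction turns the size of a chain into its length. In an oriented matroid all
  maximal chains have the same length, hence the length of the longest chain is taken.
\<close>

definition om_rank :: "'a svec set \<Rightarrow> nat" where
  "om_rank L =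
     Max {card C - 1 | C. C \<subseteq> insert None (Some ` L) \<and> Complete_Partial_Order.chain hat_le C} - 1"

definition uom_of_rank :: "'a set \<Rightarrow> 'a svec set \<Rightarrow> nat \<Rightarrow> bool" where
  "uom_of_rank U L r \<longleftrightarrow> om U L \<and> om_rank L = r \<and>
     (\<forall>X\<in>cocircuits L. card (supp U X) = card U - r + 1) \<and>
     (\<forall>A. A \<subseteq> U \<and> card A = card U - r + 1 \<longrightarrow>
        (\<exists>X. {Y \<in> cocircuits L. supp U Y = A} = {X, - X}))"

definition uom :: "'a set \<Rightarrow> 'a svec set \<Rightarrow> bool" where
  "uom U L \<longleftrightarrow> (\<exists>r. uom_of_rank U L r)"

definition face :: "'a svec set \<Rightarrow> 'a svec \<Rightarrow> 'a svec set" where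
  "face L X = scomp X ` L"

definition restrict_to :: "'a set \<Rightarrow> 'a svec \<Rightarrow> 'a svec" where
  "restrict_to A X = (\<lambda>e. if e \<in> A then X e else 0)"

definition facet :: "'a svec set \<Rightarrow> 'a svec set \<Rightarrow> bool" where
  "facet L F \<longleftrightarrow> F \<in> face L ` L \<and> (\<forall>F' \<in> face L ` L. F \<subseteq> F' \<longrightarrow> F' = F)"

definition cuom :: "'a set \<Rightarrow> 'a svec set \<Rightarrow> bool" where
  "cuom U L \<longleftrightarrow> com U L \<and>
     (\<forall>X\<in>L. facet L (face L X) \<longrightarrow>
        uom (zero_set U X) (restrict_to (zero_set U X) ` face L X))"

definition topes :: "'a set \<Rightarrow> 'a svec set \<Rightarrow> 'a svec set" where
  "topes U L = {X \<in> L. \<forall>e\<in>U. X e \<in> {-1, 1}}"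

text \<open>
  Vertices of the hypercube \<open>Q(U)\<close> are subsets of \<open>U\<close>, and a graph is a pair consisting of its
  vertex set and its set of (two-element) edges.
\<close>

definition plus_set :: "'a set \<Rightarrow> 'a svec \<Rightarrow> 'a set" where
  "plus_set U X = {e \<in> U. X e = 1}"

type_synonym 'a cube_graph = "'a set set \<times> 'a set set set"

abbreviation verts :: "'a cube_graph \<Rightarrow> 'a set set" where
  "verts G \<equiv> fst G"

abbreviation edges :: "'a cube_graph \<Rightarrow> 'a set set set" where
  "edges G \<equiv> snd G"

definition cube_subgraph :: "'a set set \<Rightarrow> 'a cube_graph" where
  "cube_subgraph S = (S, {{A, B} | A B. A \<in> S \<and> B \<in> S \<and> card ((A - B) \<union> (B - A)) = 1})"

definition tope_graph :: "'a set \<Rightarrow> 'a svec set \<Rightarrow> 'a cube_graph" where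
  "tope_graph U L = cube_subgraph (plus_set U ` topes U L)"

definition shattered :: "'a set \<Rightarrow> 'a set set \<Rightarrow> 'a set \<Rightarrow> bool" where
  "shattered U S X \<longleftrightarrow> X \<subseteq> U \<and> (\<forall>Y. Y \<subseteq> X \<longrightarrow> (\<exists>A\<in>S. A \<inter> X = Y))"

definition strongly_shattered :: "'a set \<Rightarrow> 'a set set \<Rightarrow> 'a set \<Rightarrow> bool" where
  "strongly_shattered U S X \<longleftrightarrow>
     X \<subseteq> U \<and> (\<exists>Y. Y \<subseteq> U - X \<and> {Y \<union> X' | X'. X' \<subseteq> X} \<subseteq> S)"

text \<open>
  For finite \<open>U\<close> and a nonempty family the supremum is a maximum. The empty family shatters no
  set, and its VC-dimension is \<open>0\<close> by the convention \<open>Sup {} = 0\<close> on the natural numbers.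
\<close>

definition vc_dim :: "'a set \<Rightarrow> 'a set set \<Rightarrow> nat" where
  "vc_dim U S = Sup {card X | X. shattered U S X}"

definition ample :: "'a set \<Rightarrow> 'a set set \<Rightarrow> bool" where
  "ample U S \<longleftrightarrow> S \<subseteq> Pow U \<and> (\<forall>X. shattered U S X \<longrightarrow> strongly_shattered U S X)"

definition ample_partial_cube :: "'a set \<Rightarrow> 'a cube_graph \<Rightarrow> bool" where
  "ample_partial_cube U G \<longleftrightarrow> (\<exists>S. S \<noteq> {} \<and> ample U S \<and> G = cube_subgraph S)"

end

theory Submission
  imports Defs
begin

text \<open>
  The completion is built on covectors, and the ample family is read off as a set of topes. What
  makes this work is that ampleness follows from two properties of a system \<open>M\<close> of sign vectors:
  covector elimination (SE), and upward closure, that is, every sign vector above a member of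
  \<open>M\<close> belongs to \<open>M\<close>. If the topes of \<open>M\<close> shatter \<open>A\<close>, then all sign patterns on \<open>A\<close> occur in \<open>M\<close>,
  and eliminating one coordinate of \<open>A\<close> after the other gives a member of \<open>M\<close> that vanishes on \<open>A\<close>
  (\<open>shattered_by_topes_imp_zero\<close>). Upward closure puts the whole cube above this member into the
  topes, so \<open>A\<close> is strongly shattered. In addition the VC-dimension is bounded by the size of the
  largest zero set in \<open>M\<close>. It remains to find such an \<open>M\<close> that contains the topes of \<open>L\<close> and whose
  zero sets have at most \<open>d\<close> elements.

  Uniformity enters only through \<open>uom_up_closed\<close>: in a uniform oriented matroid everything above a
  nonzero covector is a covector. The facets of a complex are the faces of its minimal covectors
  \<open>X\<close>, so a facet can fail to be upward closed only at \<open>X\<close> itself. Moreover every covector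
  \<open>W \<noteq> X\<close> of this facet has fewer than \<open>d\<close> zeros: the cubes above \<open>W\<close> and above \<open>X \<circ> - W\<close>
  together shatter the zero set of \<open>W\<close> and one further coordinate (\<open>card_zero_set_less_vc_dim\<close>).

  Each facet is then completed inside its own cube (\<open>ample_completion\<close>). Geometrically, the
  hyperplanes through the common point \<open>X\<close> of a central arrangement are pushed one after the other
  into general position, each by a much smaller amount than the one before. If more than \<open>d\<close>
  hyperplanes pass through \<open>X\<close>, this point disappears and new vertices with at most \<open>d\<close> zeros take its
  place, while all other covectors survive; otherwise the whole cube is taken.
  The completed facets are finally united. This union again satisfies elimination
  (\<open>sign_elim_union\<close>): for two members from different facets, one or both are replaced so that both
  lie in a single completed facet and all relevant signs are kept. The replacements are found above
  covectors of \<open>L\<close> that lie in this facet and differ from its base, and so have survived.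
\<close>

section \<open>Sign vectors, elimination and upward closure\<close>

text \<open>
  Sign vectors vanish outside the ground set, so elimination can be stated without mentioning it.
  The same predicate then applies to a system, to its deletions and to its faces.
\<close>

definition sign_elim :: "'a svec set \<Rightarrow> bool" where
  "sign_elim L \<longleftrightarrow> (\<forall>X\<in>L. \<forall>Y\<in>L. \<forall>e. X e * Y e = -1 \<longrightarrow>
     (\<exists>Z\<in>L. Z e = 0 \<and> (\<forall>f. X f * Y f \<noteq> -1 \<longrightarrow> Z f = scomp X Y f)))"

definition up_closed :: "'a set \<Rightarrow> 'a svec set \<Rightarrow> bool" where
  "up_closed U L \<longleftrightarrow> (\<forall>X\<in>L. \<forall>Y\<in>sign_vectors U. sle X Y \<longrightarrow> Y \<in> L)"

lemma sign_elimD: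
  assumes "sign_elim L" "X \<in> L" "Y \<in> L" "X e * Y e = -1"
  obtains Z where "Z \<in> L" "Z e = 0" "\<And>f. X f * Y f \<noteq> -1 \<Longrightarrow> Z f = scomp X Y f"
  using assms unfolding sign_elim_def by blast

lemma up_closedD: "up_closed U L \<Longrightarrow> X \<in> L \<Longrightarrow> Y \<in> sign_vectors U \<Longrightarrow> sle X Y \<Longrightarrow> Y \<in> L"
  unfolding up_closed_def by blast

lemma sign_cases: "X \<in> sign_vectors U \<Longrightarrow> X e = -1 \<or> X e = 0 \<or> X e = 1"
  unfolding sign_vectors_def by (cases "e \<in> U") auto

lemma sign_outside: "X \<in> sign_vectors U \<Longrightarrow> e \<notin> U \<Longrightarrow> X e = 0"
  unfolding sign_vectors_def by auto

lemma sign_vectorsI: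
  "(\<And>e. e \<in> U \<Longrightarrow> X e = -1 \<or> X e = 0 \<or> X e = 1) \<Longrightarrow> (\<And>e. e \<notin> U \<Longrightarrow> X e = 0)
    \<Longrightarrow> X \<in> sign_vectors U"
  unfolding sign_vectors_def by auto

lemma sign_vectors_delete: "X \<in> sign_vectors (insert b B) \<Longrightarrow> X(b := 0) \<in> sign_vectors B"
  unfolding sign_vectors_def by auto

lemma sign_vectors_extend:
  "Y \<in> sign_vectors B \<Longrightarrow> c = -1 \<or> c = 0 \<or> c = 1 \<Longrightarrow> Y(b := c) \<in> sign_vectors (insert b B)"
  unfolding sign_vectors_def by auto

lemma delete_extend: "Y \<in> sign_vectors B \<Longrightarrow> b \<notin> B \<Longrightarrow> (Y(b := c))(b := 0) = Y"
  using sign_outside[of Y B b] by auto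

lemma sle_refl [simp]: "sle X X"
  by (simp add: sle_def)

lemma sle_trans [trans]: "sle X Y \<Longrightarrow> sle Y Z \<Longrightarrow> sle X Z"
  unfolding sle_def by metis

lemma sle_scomp [simp]: "sle X (scomp X Y)"
  by (simp add: sle_def scomp_def)

lemma sle_imp_scomp_eq: "sle X Y \<Longrightarrow> scomp X Y = Y"
  by (auto simp: sle_def scomp_def fun_eq_iff)

lemma scomp_sign_vectors:
  "X \<in> sign_vectors U \<Longrightarrow> Y \<in> sign_vectors U \<Longrightarrow> scomp X Y \<in> sign_vectors U"
  unfolding sign_vectors_def scomp_def by auto

lemma scomp_commute_off_separator:
  "X f \<in> {-1, 0, 1} \<Longrightarrow> Y f \<in> {-1, 0, 1} \<Longrightarrow> X f * Y f \<noteq> -1 \<Longrightarrow> scomp X Y f = scomp Y X f"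
  by (auto simp: scomp_def)

lemma zero_set_eq: "zero_set U X = {e \<in> U. X e = 0}"
  unfolding zero_set_def supp_def by auto

lemma com_sign_elim:
  assumes "com U L"
  shows "sign_elim L"
  unfolding sign_elim_def
proof (intro ballI allI impI)
  fix X Y e assume XY: "X \<in> L" "Y \<in> L" "X e * Y e = -1"
  have sub: "L \<subseteq> sign_vectors U" using assms unfolding com_def by blast
  have out: "X f = 0" "Y f = 0" if "f \<notin> U" for f
    using sign_outside[OF subsetD[OF sub XY(1)] that] sign_outside[OF subsetD[OF sub XY(2)] that]
    by simp_all
  have "e \<in> U" using XY(3) out(1)[of e] by fastforce
  then have e: "e \<in> separator U X Y"
    using XY(3) unfolding separator_def by simp
  have "\<forall>X\<in>L. \<forall>Y\<in>L. \<forall>e\<in>separator U X Y.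
      \<exists>Z\<in>L. Z e = 0 \<and> (\<forall>f\<in>U - separator U X Y. Z f = scomp X Y f)"
    using assms unfolding com_def by (elim conjE)
  from this[rule_format, OF XY(1,2) e]
  obtain Z where Z: "Z \<in> L" "Z e = 0" "\<forall>f\<in>U - separator U X Y. Z f = scomp X Y f"
    by (elim bexE conjE)
  moreover have "Z f = scomp X Y f" if "X f * Y f \<noteq> -1" for f
  proof (cases "f \<in> U")
    case True
    then have "f \<in> U - separator U X Y" using that unfolding separator_def by simp
    then show ?thesis using Z(3) by blast
  next
    case False
    moreover have "Z f = 0" using sign_outside[OF subsetD[OF sub Z(1)] False] .
    ultimately show ?thesis using out[of f] by (simp add: scomp_def)
  qed
  ultimately show "\<exists>Z\<in>L. Z e = 0 \<and> (\<forall>f. X f * Y f \<noteq> -1 \<longrightarrow> Z f = scomp X Y f)" by blast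
qed

lemma com_scomp_uminus: "com U L \<Longrightarrow> X \<in> L \<Longrightarrow> Y \<in> L \<Longrightarrow> scomp X (- Y) \<in> L"
  unfolding com_def by blast

text \<open>Composition is face symmetry applied twice, since \<open>X \<circ> - (X \<circ> - Y) = X \<circ> Y\<close>.\<close>

lemma com_scomp:
  assumes "com U L" "X \<in> L" "Y \<in> L"
  shows "scomp X Y \<in> L"
proof -
  have "scomp X (- scomp X (- Y)) \<in> L"
    using assms com_scomp_uminus by blast
  moreover have "scomp X (- scomp X (- Y)) = scomp X Y"
    by (auto simp: scomp_def fun_eq_iff)
  ultimately show ?thesis by simp
qed

section \<open>Ample completion of a system that is upward closed away from zero\<close>

lemma sign_elim_sign_vectors: "sign_elim (sign_vectors U)"
  unfolding sign_elim_def
proof (intro ballI allI impI)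
  fix X Y :: "'a svec" and e
  assume "X \<in> sign_vectors U" "Y \<in> sign_vectors U" and e: "X e * Y e = -1"
  then have "(scomp X Y)(e := 0) \<in> sign_vectors U"
    unfolding sign_vectors_def scomp_def by auto
  then show "\<exists>Z\<in>sign_vectors U. Z e = 0 \<and> (\<forall>f. X f * Y f \<noteq> -1 \<longrightarrow> Z f = scomp X Y f)"
    using e by (intro bexI[of _ "(scomp X Y)(e := 0)"]) auto
qed

lemma ample_completion_small_ground_set:
  assumes "finite B" "card B \<le> r"
  shows "sign_vectors B \<noteq> {} \<and> sign_elim (sign_vectors B) \<and> up_closed B (sign_vectors B) \<and>
    (\<forall>W\<in>sign_vectors B. card (zero_set B W) \<le> r)"
proof -
  have "card (zero_set B W) \<le> r" for W
    using card_mono[OF assms(1), of "zero_set B W"] assms(2) unfolding zero_set_eq by auto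
  moreover have "(\<lambda>_. 0) \<in> sign_vectors B" by (simp add: sign_vectors_def)
  ultimately show ?thesis
    using sign_elim_sign_vectors unfolding up_closed_def by blast
qed

text \<open>
  The elimination step for a displaced hyperplane. The layer \<open>b = -1\<close> carries the larger system
  \<open>M\<close>, while the layers \<open>b = 0\<close> and \<open>b = 1\<close> carry \<open>P\<close>. Eliminating in \<open>M\<close> may leave \<open>P\<close>, and then
  the sign at \<open>b\<close> has to be \<open>-1\<close>; this is admissible, because it only happens when one of the two
  given vectors already has this sign.
\<close>

lemma sign_elim_two_layers:
  fixes M P :: "'a svec set"
  assumes M: "sign_elim M" and P: "sign_elim P" and PM: "P \<subseteq> M"
    and up: "\<And>X Y. X \<in> P \<Longrightarrow> Y \<in> M \<Longrightarrow> scomp X Y \<in> P"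
    and M_sub: "M \<subseteq> sign_vectors B" and bB: "b \<notin> B"
  shows "sign_elim {W. (W b = -1 \<or> W b = 0 \<or> W b = 1) \<and> (W(b := 0) \<in> P \<or> W b = -1 \<and> W(b := 0) \<in> M)}"
    (is "sign_elim ?N")
  unfolding sign_elim_def
proof (intro ballI allI impI)
  have b: "X b = 0" if "X \<in> M" for X
    using sign_outside[OF subsetD[OF M_sub that] bB] .
  fix X Y e
  assume X: "X \<in> ?N" and Y: "Y \<in> ?N" and e: "X e * Y e = -1"
  let ?goal = "\<exists>Z\<in>?N. Z e = 0 \<and> (\<forall>f. X f * Y f \<noteq> -1 \<longrightarrow> Z f = scomp X Y f)"
  have XM: "X(b := 0) \<in> M" and YM: "Y(b := 0) \<in> M" using X Y PM by blast+
  have Xb: "X b = -1 \<or> X b = 0 \<or> X b = 1" and Yb: "Y b = -1 \<or> Y b = 0 \<or> Y b = 1"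
    using X Y by blast+
  have XP: "X(b := 0) \<in> P" if "X b \<noteq> -1" using X that by blast
  have YP: "Y(b := 0) \<in> P" if "Y b \<noteq> -1" using Y that by blast
  show ?goal
  proof (cases "e = b")
    case True
    \<comment> \<open>One of the two vectors has sign \<open>+\<close> at \<open>b\<close> and lies over \<open>P\<close>; above it, the composition
      itself with \<open>b\<close> set to \<open>0\<close> is available.\<close>
    have "X b = 1 \<or> Y b = 1" using Xb Yb e True by auto
    then have "scomp (X(b := 0)) (Y(b := 0)) \<in> P \<or> scomp (Y(b := 0)) (X(b := 0)) \<in> P"
      using up[OF XP YM] up[OF YP XM] by auto
    then show ?thesis
    proof
      assume in_P: "scomp (X(b := 0)) (Y(b := 0)) \<in> P"
      let ?Z = "scomp (X(b := 0)) (Y(b := 0))"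
      have Zb: "?Z b = 0" by (simp add: scomp_def)
      then have "?Z(b := 0) = ?Z" by auto
      then have "?Z \<in> ?N" using in_P Zb by simp
      moreover have "\<forall>f. X f * Y f \<noteq> -1 \<longrightarrow> ?Z f = scomp X Y f"
        using e True by (auto simp: scomp_def)
      ultimately show ?thesis using Zb True by blast
    next
      assume in_P: "scomp (Y(b := 0)) (X(b := 0)) \<in> P"
      let ?Z = "scomp (Y(b := 0)) (X(b := 0))"
      have Zb: "?Z b = 0" by (simp add: scomp_def)
      then have "?Z(b := 0) = ?Z" by auto
      then have "?Z \<in> ?N" using in_P Zb by simp
      moreover have "\<forall>f. X f * Y f \<noteq> -1 \<longrightarrow> ?Z f = scomp X Y f"
      proof (intro allI impI)
        fix f assume f: "X f * Y f \<noteq> -1"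
        show "?Z f = scomp X Y f"
        proof (cases "f = b")
          case True
          then show ?thesis using f e \<open>e = b\<close> by simp
        next
          case False
          then have "X f \<in> {-1, 0, 1}" "Y f \<in> {-1, 0, 1}"
            using M_sub XM YM sign_cases[of "X(b := 0)" B f] sign_cases[of "Y(b := 0)" B f] by auto
          then show ?thesis
            using False f scomp_commute_off_separator[of X f Y] by (simp add: scomp_def)
        qed
      qed
      ultimately show ?thesis using Zb True by blast
    qed
  next
    case False
    then have e': "(X(b := 0)) e * (Y(b := 0)) e = -1" using e by simp
    show ?thesis
    proof (cases "X(b := 0) \<in> P \<and> Y(b := 0) \<in> P")
      case True
      then have XYP: "X(b := 0) \<in> P" "Y(b := 0) \<in> P" by blast+
      obtain Z where Z: "Z \<in> P" "Z e = 0"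
        "\<And>f. (X(b := 0)) f * (Y(b := 0)) f \<noteq> -1 \<Longrightarrow> Z f = scomp (X(b := 0)) (Y(b := 0)) f"
        using sign_elimD[OF P XYP e'] by blast
      let ?Z = "Z(b := scomp X Y b)"
      have "Z b = 0" using b Z(1) PM by blast
      then have "?Z(b := 0) = Z" by auto
      moreover have "scomp X Y b \<in> {-1, 0, 1}" using Xb Yb by (auto simp: scomp_def)
      ultimately have "?Z \<in> ?N" using Z(1) by simp
      moreover have "?Z f = scomp X Y f" if "X f * Y f \<noteq> -1" for f
        using Z(3)[of f] that by (auto simp: scomp_def)
      ultimately show ?thesis using Z(2) False by (intro bexI[of _ ?Z]) auto
    next
      case nP: False
      obtain Z where Z: "Z \<in> M" "Z e = 0"
        "\<And>f. (X(b := 0)) f * (Y(b := 0)) f \<noteq> -1 \<Longrightarrow> Z f = scomp (X(b := 0)) (Y(b := 0)) f"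
        using sign_elimD[OF M XM YM e'] by blast
      let ?Z = "Z(b := -1)"
      have "Z b = 0" using b Z(1) by blast
      then have "?Z(b := 0) = Z" by auto
      then have "?Z \<in> ?N" using Z(1) by simp
      moreover have "?Z f = scomp X Y f" if "X f * Y f \<noteq> -1" for f
      proof (cases "f = b")
        case True
        moreover have "X b = -1 \<or> Y b = -1" using XP YP nP by blast
        ultimately show ?thesis using Xb Yb that by (auto simp: scomp_def)
      next
        case False
        then show ?thesis using Z(3)[of f] that by (auto simp: scomp_def)
      qed
      ultimately show ?thesis using Z(2) False by (intro bexI[of _ ?Z]) auto
    qed
  qed
qed

text \<open>
  The hypotheses describe a central system that is upward closed away from its center, and the
  conclusion says that the center can be resolved at the price of one more zero. The proof removes
  one element \<open>b\<close>, completes the deletion \<open>M\<close> to \<open>M'\<close>, and reinserts \<open>b\<close> as a hyperplane that is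
  displaced far towards its positive side compared with everything done to the others. Hence on the
  negative side one sees all of \<open>M'\<close>, whereas the displaced hyperplane and its positive side show
  the system \<open>P\<close> of those vectors that occur in \<open>L\<close> together with \<open>b = 1\<close>. The recursion stops
  when at most \<open>r\<close> elements are left, where the full set of sign vectors is a completion.
\<close>

lemma ample_completion:
  fixes L :: "'a svec set"
  assumes "finite B" "L \<subseteq> sign_vectors B" "sign_elim L" "up_closed B (L - {\<lambda>_. 0})"
    and "\<And>W. W \<in> L \<Longrightarrow> W \<noteq> (\<lambda>_. 0) \<Longrightarrow> card (zero_set B W) < r"
  shows "\<exists>N. N \<subseteq> sign_vectors B \<and> N \<noteq> {} \<and> L - {\<lambda>_. 0} \<subseteq> N \<and> sign_elim N \<and> up_closed B N \<and>
    (\<forall>W\<in>N. card (zero_set B W) \<le> r)"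
  using assms
proof (induction B arbitrary: L rule: finite_induct)
  case empty
  then show ?case
    using ample_completion_small_ground_set[of "{} :: 'a set" r]
    by (intro exI[of _ "sign_vectors {}"]) auto
next
  case (insert b B)
  show ?case
  proof (cases "card (insert b B) \<le> r")
    case True
    then show ?thesis
      using ample_completion_small_ground_set[of "insert b B" r] insert.hyps insert.prems(1)
      by (intro exI[of _ "sign_vectors (insert b B)"]) auto
  next
    case False
    then have rB: "r \<le> card B" using insert.hyps by simp
    have finB: "finite B" by fact
    note sub = insert.prems(1) and elim = insert.prems(2) and up = insert.prems(3)
      and small = insert.prems(4)
    define M where "M = (\<lambda>X. X(b := 0)) ` L"
    define P where "P = {Y. Y b = 0 \<and> Y(b := 1) \<in> L}"
    \<comment> \<open>A vector supported by \<open>b\<close> alone would have \<open>card B \<ge> r\<close> zeros, which is too many.\<close>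
    have b_only: "X(b := 0) \<noteq> (\<lambda>_. 0)" if X: "X \<in> L" "X \<noteq> (\<lambda>_. 0)" for X
    proof
      assume "X(b := 0) = (\<lambda>_. 0)"
      then have "X f = 0" if "f \<in> B" for f
        using that insert.hyps(2) by (metis fun_upd_other)
      then have "B \<subseteq> zero_set (insert b B) X"
        using insert.hyps unfolding zero_set_eq by auto
      then have "card B \<le> card (zero_set (insert b B) X)"
        using finB by (intro card_mono) (auto simp: zero_set_eq)
      then show False using small[OF X] rB by simp
    qed
    have M_sub: "M \<subseteq> sign_vectors B"
      unfolding M_def
    proof (rule image_subsetI)
      show "X(b := 0) \<in> sign_vectors B" if "X \<in> L" for X
        using sign_vectors_delete[OF subsetD[OF sub that]] .
    qed
    have M_elim: "sign_elim M"
      unfolding sign_elim_def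
    proof (intro ballI allI impI)
      fix X' Y' e assume "X' \<in> M" "Y' \<in> M" and e: "X' e * Y' e = -1"
      then obtain X Y where XY: "X \<in> L" "Y \<in> L" "X' = X(b := 0)" "Y' = Y(b := 0)"
        unfolding M_def by blast
      then have "X e * Y e = -1" using e by (auto split: if_splits)
      then obtain Z where Z: "Z \<in> L" "Z e = 0" "\<And>f. X f * Y f \<noteq> -1 \<Longrightarrow> Z f = scomp X Y f"
        using sign_elimD[OF elim XY(1,2)] by blast
      have "Z(b := 0) \<in> M" using Z(1) unfolding M_def by blast
      moreover have "(Z(b := 0)) f = scomp X' Y' f" if "X' f * Y' f \<noteq> -1" for f
        using Z(3)[of f] that XY(3,4) by (auto simp: scomp_def)
      ultimately show "\<exists>Z\<in>M. Z e = 0 \<and> (\<forall>f. X' f * Y' f \<noteq> -1 \<longrightarrow> Z f = scomp X' Y' f)"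
        using Z(2) by (intro bexI[of _ "Z(b := 0)"]) auto
    qed
    have M_up: "up_closed B (M - {\<lambda>_. 0})"
      unfolding up_closed_def
    proof (intro ballI impI)
      fix X' Y assume "X' \<in> M - {\<lambda>_. 0}" and Y: "Y \<in> sign_vectors B" and le: "sle X' Y"
      then obtain X where X: "X \<in> L" "X' = X(b := 0)" "X' \<noteq> (\<lambda>_. 0)" unfolding M_def by blast
      have "Y(b := X b) \<in> sign_vectors (insert b B)"
        using sign_vectors_extend[OF Y sign_cases[OF subsetD[OF sub X(1)]]] .
      moreover have "sle X (Y(b := X b))"
        using le X(2) unfolding sle_def by (auto split: if_splits)
      moreover have "X \<noteq> (\<lambda>_. 0)" using X(2,3) by auto
      ultimately have "Y(b := X b) \<in> L"
        using up_closedD[OF up] X(1) by blast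
      then have "Y \<in> M"
        using delete_extend[OF Y \<open>b \<notin> B\<close>] unfolding M_def by (metis image_eqI)
      moreover have "Y \<noteq> (\<lambda>_. 0)" using le X(3) unfolding sle_def by auto
      ultimately show "Y \<in> M - {\<lambda>_. 0}" by simp
    qed
    have M_small: "card (zero_set B W) < r" if W: "W \<in> M" "W \<noteq> (\<lambda>_. 0)" for W
    proof -
      obtain X where X: "X \<in> L" "W = X(b := 0)" "X \<noteq> (\<lambda>_. 0)"
        using W unfolding M_def by auto
      have "card (zero_set B W) \<le> card (zero_set (insert b B) X)"
        using finB X(2) insert.hyps by (intro card_mono) (auto simp: zero_set_eq)
      then show ?thesis using small[OF X(1,3)] by simp
    qed
    obtain M' where M': "M' \<subseteq> sign_vectors B" "M' \<noteq> {}" "M - {\<lambda>_. 0} \<subseteq> M'" "sign_elim M'"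
        "up_closed B M'" "\<And>W. W \<in> M' \<Longrightarrow> card (zero_set B W) \<le> r"
      using insert.IH[OF M_sub M_elim M_up M_small] by blast
    have P_sub: "P \<subseteq> sign_vectors B"
    proof
      fix Y assume "Y \<in> P"
      then have "Y(b := 1) \<in> L" and "Y b = 0" unfolding P_def by simp_all
      then have "(Y(b := 1))(b := 0) \<in> sign_vectors B" and "Y b = 0"
        using sign_vectors_delete[OF subsetD[OF sub]] by (simp_all only:)
      then show "Y \<in> sign_vectors B" by (simp add: fun_upd_idem)
    qed
    have upd_nz: "Y(b := 1) \<noteq> (\<lambda>_. 0)" for Y :: "'a svec"
      by (metis fun_upd_same zero_neq_one)
    have P_up: "up_closed B P"
      unfolding up_closed_def
    proof (intro ballI impI)
      fix X Y assume X: "X \<in> P" and Y: "Y \<in> sign_vectors B" and le: "sle X Y"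
      have "Y(b := 1) \<in> sign_vectors (insert b B)"
        by (rule sign_vectors_extend[OF Y]) simp
      moreover have "sle (X(b := 1)) (Y(b := 1))"
        using le unfolding sle_def by auto
      ultimately have "Y(b := 1) \<in> L"
        using up_closedD[OF up] X upd_nz unfolding P_def by blast
      then show "Y \<in> P" using sign_outside[OF Y] insert.hyps unfolding P_def by simp
    qed
    have P_elim: "sign_elim P"
      unfolding sign_elim_def
    proof (intro ballI allI impI)
      fix X Y e assume XY: "X \<in> P" "Y \<in> P" and e: "X e * Y e = -1"
      have "e \<noteq> b" using XY(1) e unfolding P_def by auto
      then have "(X(b := 1)) e * (Y(b := 1)) e = -1" using e by simp
      then obtain Z where Z: "Z \<in> L" "Z e = 0"
        "\<And>f. (X(b := 1)) f * (Y(b := 1)) f \<noteq> -1 \<Longrightarrow> Z f = scomp (X(b := 1)) (Y(b := 1)) f"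
        using sign_elimD[OF elim, of "X(b := 1)" "Y(b := 1)"] XY unfolding P_def by blast
      have "Z b = 1" using Z(3)[of b] by (simp add: scomp_def)
      then have "(Z(b := 0))(b := 1) = Z" by auto
      then have "Z(b := 0) \<in> P" using Z(1) unfolding P_def by simp
      moreover have "(Z(b := 0)) f = scomp X Y f" if "X f * Y f \<noteq> -1" for f
        using Z(3)[of f] that XY unfolding P_def by (auto simp: scomp_def)
      ultimately show "\<exists>Z\<in>P. Z e = 0 \<and> (\<forall>f. X f * Y f \<noteq> -1 \<longrightarrow> Z f = scomp X Y f)"
        using Z(2) by (intro bexI[of _ "Z(b := 0)"]) auto
    qed
    have P_M': "P \<subseteq> M'"
    proof
      fix Y assume Y: "Y \<in> P"
      then have eq: "(Y(b := 1))(b := 0) = Y" unfolding P_def by auto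
      have "Y(b := 1) \<in> L" using Y unfolding P_def by simp
      then have "Y \<in> M" "Y \<noteq> (\<lambda>_. 0)"
        using eq b_only[of "Y(b := 1)"] upd_nz unfolding M_def by (metis image_eqI, metis)
      then show "Y \<in> M'" using M'(3) by blast
    qed
    define N where
      "N = {W. (W b = -1 \<or> W b = 0 \<or> W b = 1) \<and> (W(b := 0) \<in> P \<or> W b = -1 \<and> W(b := 0) \<in> M')}"
    have N_sub: "N \<subseteq> sign_vectors (insert b B)"
    proof
      fix W assume W: "W \<in> N"
      then have "W(b := 0) \<in> sign_vectors B" "W b \<in> {-1, 0, 1}"
        using P_sub M'(1) unfolding N_def by blast+
      then show "W \<in> sign_vectors (insert b B)"
        unfolding sign_vectors_def by (auto split: if_splits)
    qed
    have N_ne: "N \<noteq> {}"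
    proof -
      obtain W where W: "W \<in> M'" using M'(2) by blast
      have "(W(b := -1))(b := 0) = W" using delete_extend[OF subsetD[OF M'(1) W] \<open>b \<notin> B\<close>] .
      then have "W(b := -1) \<in> N" using W unfolding N_def by simp
      then show ?thesis by blast
    qed
    have N_elim: "sign_elim N"
      unfolding N_def
    proof (rule sign_elim_two_layers[OF M'(4) P_elim P_M' _ M'(1) \<open>b \<notin> B\<close>])
      show "scomp X Y \<in> P" if "X \<in> P" "Y \<in> M'" for X Y
        using up_closedD[OF P_up that(1) scomp_sign_vectors[OF subsetD[OF P_sub that(1)]
            subsetD[OF M'(1) that(2)]] sle_scomp] .
    qed
    have N_up: "up_closed (insert b B) N"
      unfolding up_closed_def
    proof (intro ballI impI)
      fix X Y assume X: "X \<in> N" and Y: "Y \<in> sign_vectors (insert b B)" and le: "sle X Y"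
      have Y0: "Y(b := 0) \<in> sign_vectors B"
        using sign_vectors_delete[OF Y] .
      have le0: "sle (X(b := 0)) (Y(b := 0))" using le unfolding sle_def by auto
      have "Y b \<in> {-1, 0, 1}" using sign_cases[OF Y, of b] by auto
      moreover have "Y b = -1" if "X b = -1" using le that unfolding sle_def by (metis zero_neq_neg_one)
      ultimately show "Y \<in> N"
        using X up_closedD[OF P_up _ Y0 le0] up_closedD[OF M'(5) _ Y0 le0] unfolding N_def by auto
    qed
    have N_L: "L - {\<lambda>_. 0} \<subseteq> N"
    proof
      fix W assume "W \<in> L - {\<lambda>_. 0}"
      then have W: "W \<in> L" "W \<noteq> (\<lambda>_. 0)" by auto
      have Wv: "W \<in> sign_vectors (insert b B)" using W(1) sub by blast
      have "W(b := 0) \<in> M'" using M'(3) b_only[OF W] W(1) unfolding M_def by auto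
      \<comment> \<open>If \<open>W\<close> is \<open>0\<close> at \<open>b\<close>, upward closure supplies the vector with \<open>1\<close> instead.\<close>
      moreover have "W(b := 0) \<in> P" if "W b \<noteq> -1"
      proof -
        have "W(b := 1) \<in> sign_vectors (insert b B)"
          using sign_vectors_extend[OF sign_vectors_delete[OF Wv], of 1 b] by simp
        moreover have "sle W (W(b := 1))"
          using that sign_cases[OF Wv, of b] unfolding sle_def by auto
        ultimately have "W(b := 1) \<in> L" using up_closedD[OF up] W by blast
        then show ?thesis unfolding P_def by simp
      qed
      ultimately show "W \<in> N" using sign_cases[OF Wv, of b] unfolding N_def by auto
    qed
    have N_small: "card (zero_set (insert b B) W) \<le> r" if W: "W \<in> N" for W
    proof (cases "W(b := 0) \<in> P")
      case True
      then have "W(b := 1) \<in> L" unfolding P_def by simp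
      then have "card (zero_set (insert b B) (W(b := 1))) < r" using small upd_nz by blast
      moreover have "card (zero_set (insert b B) W) \<le> card (insert b (zero_set (insert b B) (W(b := 1))))"
        using finB by (intro card_mono) (auto simp: zero_set_eq)
      moreover have "\<dots> \<le> Suc (card (zero_set (insert b B) (W(b := 1))))"
        using finB by (simp add: card_insert_if zero_set_eq)
      ultimately show ?thesis by simp
    next
      case False
      then have "W b = -1" "W(b := 0) \<in> M'" using W unfolding N_def by auto
      moreover have "zero_set (insert b B) W = zero_set B (W(b := 0))"
        using \<open>W b = -1\<close> insert.hyps unfolding zero_set_eq by auto
      ultimately show ?thesis using M'(6) by simp
    qed
    show ?thesis
      using N_sub N_ne N_L N_elim N_up N_small by blast
  qed
qed

section \<open>Shattering by the topes of an upward closed system\<close>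

text \<open>
  The vertex of the cube above \<open>Z\<close> whose positive coordinates in the zero set of \<open>Z\<close> are those of
  \<open>Y\<close>.
\<close>

definition fill :: "'a set \<Rightarrow> 'a svec \<Rightarrow> 'a set \<Rightarrow> 'a svec" where
  "fill U Z Y = (\<lambda>e. if e \<notin> U then 0 else if Z e \<noteq> 0 then Z e else if e \<in> Y then 1 else -1)"

lemma fill_sign_vectors: "Z \<in> sign_vectors U \<Longrightarrow> fill U Z Y \<in> sign_vectors U"
  by (rule sign_vectorsI) (use sign_cases[of Z U] in \<open>auto simp: fill_def\<close>)

lemma sle_fill: "Z \<in> sign_vectors U \<Longrightarrow> sle Z (fill U Z Y)"
  using sign_outside[of Z U] unfolding sle_def fill_def by auto

lemma fill_in_topes:
  "Z \<in> sign_vectors U \<Longrightarrow> fill U Z Y \<in> L \<Longrightarrow> fill U Z Y \<in> topes U L"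
  using sign_cases[of Z U] unfolding topes_def fill_def by fastforce

lemma plus_set_fill: "plus_set U (fill U Z Y) = plus_set U Z \<union> (Y \<inter> zero_set U Z)"
  unfolding plus_set_def fill_def zero_set_eq by auto

lemma sign_elim_coordinate_halfspace:
  assumes "sign_elim L" "c = 1 \<or> c = -1"
  shows "sign_elim {W \<in> L. W e = c}"
  unfolding sign_elim_def
proof (intro ballI allI impI)
  fix X Y g assume X: "X \<in> {W \<in> L. W e = c}" and Y: "Y \<in> {W \<in> L. W e = c}" and g: "X g * Y g = -1"
  have XL: "X \<in> L" "Y \<in> L" "X e = c" "Y e = c" using X Y by simp_all
  obtain Z where Z: "Z \<in> L" "Z g = 0" "\<And>f. X f * Y f \<noteq> -1 \<Longrightarrow> Z f = scomp X Y f"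
    using sign_elimD[OF assms(1) XL(1,2) g] by blast
  have "Z e = c" using Z(3)[of e] XL(3,4) assms(2) by (auto simp: scomp_def)
  then show "\<exists>Z\<in>{W \<in> L. W e = c}. Z g = 0 \<and> (\<forall>f. X f * Y f \<noteq> -1 \<longrightarrow> Z f = scomp X Y f)"
    using Z by (intro bexI[of _ Z]) simp_all
qed

text \<open>
  Within each of the half-spaces \<open>e = 1\<close> and \<open>e = -1\<close>, all patterns on the other coordinates still
  occur, so by induction each of them contains a vector that vanishes on these coordinates.
  Eliminating \<open>e\<close> between the two vectors creates no new nonzero entry.
\<close>

lemma sign_elim_all_patterns_imp_zero:
  assumes "finite A" "sign_elim L"
    and "\<And>Y. Y \<subseteq> A \<Longrightarrow> \<exists>W\<in>L. \<forall>a\<in>A. W a = (if a \<in> Y then 1 else -1)"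
  shows "\<exists>Z\<in>L. \<forall>a\<in>A. Z a = 0"
  using assms
proof (induction A arbitrary: L rule: finite_induct)
  case empty
  then show ?case by blast
next
  case (insert e A)
  have half: "\<exists>Z\<in>{W \<in> L. W e = c}. \<forall>a\<in>A. Z a = 0" if c: "c = 1 \<or> c = -1" for c
  proof (rule insert.IH[OF sign_elim_coordinate_halfspace[OF insert.prems(1) c]])
    fix Y assume Y: "Y \<subseteq> A"
    define Y' where "Y' = (if c = 1 then insert e Y else Y)"
    have "Y' \<subseteq> insert e A" using Y unfolding Y'_def by auto
    then obtain W where W: "W \<in> L" "\<forall>a\<in>insert e A. W a = (if a \<in> Y' then 1 else -1)"
      using insert.prems(2) by blast
    have "e \<notin> Y" using Y insert.hyps(2) by blast
    then have "W e = c" using W(2) c unfolding Y'_def by (auto split: if_splits)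
    moreover have "W a = (if a \<in> Y then 1 else -1)" if "a \<in> A" for a
      using W(2) that insert.hyps(2) unfolding Y'_def by auto
    ultimately show "\<exists>W\<in>{W \<in> L. W e = c}. \<forall>a\<in>A. W a = (if a \<in> Y then 1 else -1)"
      using W(1) by blast
  qed
  obtain X where X: "X \<in> L" "X e = 1" "\<forall>a\<in>A. X a = 0" using half[of 1] by blast
  obtain Y where Y: "Y \<in> L" "Y e = -1" "\<forall>a\<in>A. Y a = 0" using half[of "-1"] by blast
  have "X e * Y e = -1" using X(2) Y(2) by simp
  then obtain Z where Z: "Z \<in> L" "Z e = 0" "\<And>f. X f * Y f \<noteq> -1 \<Longrightarrow> Z f = scomp X Y f"
    using sign_elimD[OF insert.prems(1) X(1) Y(1)] by blast
  have "Z a = 0" if "a \<in> A" for a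
    using Z(3)[of a] X(3) Y(3) that by (simp add: scomp_def)
  then show ?case using Z(1,2) by (intro bexI[of _ Z]) auto
qed

lemma shattered_by_topes_imp_zero:
  assumes "finite U" "sign_elim L" "shattered U (plus_set U ` topes U L) A"
  shows "\<exists>Z\<in>L. A \<subseteq> zero_set U Z"
proof -
  have A: "A \<subseteq> U" using assms(3) unfolding shattered_def by blast
  have "\<exists>W\<in>L. \<forall>a\<in>A. W a = (if a \<in> Y then 1 else -1)" if Y: "Y \<subseteq> A" for Y
  proof -
    obtain W where W: "W \<in> topes U L" "plus_set U W \<inter> A = Y"
      using assms(3) Y unfolding shattered_def by blast
    have "W a = (if a \<in> Y then 1 else -1)" if a: "a \<in> A" for a
    proof -
      have "W a \<in> {-1, 1}" using W(1) a A unfolding topes_def by blast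
      moreover have "a \<in> Y \<longleftrightarrow> W a = 1" using W(2) a A unfolding plus_set_def by blast
      ultimately show ?thesis by auto
    qed
    moreover have "W \<in> L" using W(1) unfolding topes_def by blast
    ultimately show ?thesis by blast
  qed
  then obtain Z where "Z \<in> L" "\<forall>a\<in>A. Z a = 0"
    using sign_elim_all_patterns_imp_zero[OF finite_subset[OF A assms(1)] assms(2)] by blast
  then show ?thesis using A unfolding zero_set_eq by blast
qed

lemma zero_imp_strongly_shattered:
  assumes "L \<subseteq> sign_vectors U" "up_closed U L" "Z \<in> L" "A \<subseteq> zero_set U Z"
  shows "strongly_shattered U (plus_set U ` topes U L) A"
proof -
  have Z: "Z \<in> sign_vectors U" using assms(1,3) by blast
  have "plus_set U Z \<subseteq> U - A" using assms(4) unfolding plus_set_def zero_set_eq by auto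
  moreover have "plus_set U Z \<union> X \<in> plus_set U ` topes U L" if X: "X \<subseteq> A" for X
  proof -
    have "fill U Z X \<in> L"
      using up_closedD[OF assms(2,3) fill_sign_vectors[OF Z] sle_fill[OF Z]] .
    then have "plus_set U (fill U Z X) \<in> plus_set U ` topes U L"
      using fill_in_topes[OF Z] by blast
    moreover have "plus_set U (fill U Z X) = plus_set U Z \<union> X"
      using X assms(4) by (auto simp: plus_set_fill)
    ultimately show ?thesis by simp
  qed
  moreover have "A \<subseteq> U" using assms(4) unfolding zero_set_eq by blast
  ultimately show ?thesis unfolding strongly_shattered_def by blast
qed

lemma ample_topes:
  assumes "finite U" "L \<subseteq> sign_vectors U" "sign_elim L" "up_closed U L"
  shows "ample U (plus_set U ` topes U L)"
  unfolding ample_def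
proof (intro conjI allI impI)
  show "plus_set U ` topes U L \<subseteq> Pow U" unfolding plus_set_def by blast
  fix A assume "shattered U (plus_set U ` topes U L) A"
  then obtain Z where "Z \<in> L" "A \<subseteq> zero_set U Z"
    using shattered_by_topes_imp_zero[OF assms(1,3)] by blast
  then show "strongly_shattered U (plus_set U ` topes U L) A"
    by (rule zero_imp_strongly_shattered[OF assms(2,4)])
qed

lemma card_le_vc_dim:
  assumes "finite U" "shattered U S A"
  shows "card A \<le> vc_dim U S"
  unfolding vc_dim_def
proof (rule cSup_upper)
  show "card A \<in> {card X |X. shattered U S X}" using assms(2) by blast
  have "{card X |X. shattered U S X} \<subseteq> card ` Pow U" unfolding shattered_def by blast
  then show "bdd_above {card X |X. shattered U S X}"
    using assms(1) by (meson bdd_above_finite finite_Pow_iff finite_imageI finite_subset)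
qed

lemma vc_dim_le:
  assumes "\<And>A. shattered U S A \<Longrightarrow> card A \<le> d"
  shows "vc_dim U S \<le> d"
proof (cases "{card X |X. shattered U S X} = {}")
  case True
  then show ?thesis unfolding vc_dim_def by simp
next
  case False
  then show ?thesis unfolding vc_dim_def
    by (rule cSup_least) (use assms in blast)
qed

lemma vc_dim_mono:
  assumes "finite U" "S \<subseteq> T"
  shows "vc_dim U S \<le> vc_dim U T"
proof (rule vc_dim_le)
  fix A assume "shattered U S A"
  then have "shattered U T A" using assms(2) unfolding shattered_def by blast
  then show "card A \<le> vc_dim U T" by (rule card_le_vc_dim[OF assms(1)])
qed

section \<open>Uniform oriented matroids\<close>

lemma exists_minimal_below:
  assumes "finite U" "L \<subseteq> sign_vectors U" "W \<in> L" "Q W"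
  shows "\<exists>C\<in>L. Q C \<and> sle C W \<and> (\<forall>Y\<in>L. Q Y \<and> sle Y C \<longrightarrow> Y = C)"
proof -
  obtain C where C: "C \<in> L" "Q C" "sle C W"
    and least: "\<And>Y. Y \<in> L \<and> Q Y \<and> sle Y W \<Longrightarrow> card (supp U C) \<le> card (supp U Y)"
    using ex_has_least_nat[of "\<lambda>C. C \<in> L \<and> Q C \<and> sle C W" W "\<lambda>C. card (supp U C)"] assms(3,4)
    by auto
  have "Y = C" if Y: "Y \<in> L" "Q Y" "sle Y C" for Y
  proof -
    have sub: "supp U Y \<subseteq> supp U C" using Y(3) unfolding sle_def supp_def by auto
    have "finite (supp U C)" using assms(1) unfolding supp_def by simp
    moreover have "card (supp U C) \<le> card (supp U Y)"
      using least[of Y] Y sle_trans[OF Y(3) C(3)] by blast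
    ultimately have eq: "supp U Y = supp U C" using sub by (metis card_seteq)
    show "Y = C"
    proof
      fix e
      show "Y e = C e"
      proof (cases "e \<in> U")
        case True
        then show ?thesis using eq Y(3) unfolding sle_def supp_def by auto
      next
        case False
        then show ?thesis
          using sign_outside[OF subsetD[OF assms(2) Y(1)]] sign_outside[OF subsetD[OF assms(2) C(1)]]
          by simp
      qed
    qed
  qed
  then show ?thesis using C by blast
qed

text \<open>
  Any set of cocircuit size is the support of a cocircuit and of its opposite. The set used here
  exchanges an element of the support of \<open>C\<close> for \<open>e\<close>, so that \<open>e\<close> is the only element of the zero
  set of \<open>C\<close> that it meets.
\<close>

lemma uom_vector_crossing_one_element:
  assumes "finite B" "uom B K" "C \<in> cocircuits K" "e \<in> B" "C e = 0" "s = 1 \<or> s = -1"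
  shows "\<exists>D\<in>K. D e = s \<and> (\<forall>f\<in>B. C f = 0 \<and> f \<noteq> e \<longrightarrow> D f = 0)"
proof -
  obtain r where om: "om B K" and size: "\<And>X. X \<in> cocircuits K \<Longrightarrow> card (supp B X) = card B - r + 1"
    and sign: "\<And>A. A \<subseteq> B \<Longrightarrow> card A = card B - r + 1 \<Longrightarrow>
        \<exists>X. {Y \<in> cocircuits K. supp B Y = A} = {X, - X}"
    using assms(2) unfolding uom_def uom_of_rank_def by auto
  have fin: "finite (supp B C)" using assms(1) unfolding supp_def by simp
  have "card (supp B C) \<noteq> 0" using size[OF assms(3)] by simp
  then obtain a where a: "a \<in> supp B C" by fastforce
  define A where "A = insert e (supp B C - {a})"
  have "e \<notin> supp B C" using assms(5) unfolding supp_def by simp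
  then have "card A = card (supp B C)"
    unfolding A_def using fin a card_Suc_Diff1[OF fin a] by simp
  moreover have "A \<subseteq> B" using assms(4) unfolding A_def supp_def by auto
  ultimately obtain X where "{Y \<in> cocircuits K. supp B Y = A} = {X, - X}"
    using sign[of A] size[OF assms(3)] by auto
  then have X: "Y \<in> cocircuits K" "supp B Y = A" if "Y = X \<or> Y = - X" for Y
    using that by blast+
  have XK: "X \<in> K" "- X \<in> K" using X(1) unfolding cocircuits_def by blast+
  have "K \<subseteq> sign_vectors B" using om unfolding om_def com_def by blast
  then have Xe: "X e = 1 \<or> X e = -1"
    using XK(1) sign_cases[of X B e] X(2)[of X] unfolding A_def supp_def by fastforce
  have off: "X f = 0" if "f \<in> B" "C f = 0" "f \<noteq> e" for f
  proof -
    have "f \<notin> A" using that unfolding A_def supp_def by simp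
    then show ?thesis using X(2)[of X] that(1) unfolding supp_def by blast
  qed
  show ?thesis
  proof (cases "X e = s")
    case True
    then show ?thesis using XK(1) off by blast
  next
    case False
    then have "(- X) e = s" using Xe assms(6) by auto
    then show ?thesis using XK(2) off by (intro bexI[of _ "- X"]) auto
  qed
qed

text \<open>
  Below \<open>W\<close> lies a cocircuit \<open>C\<close>. The vectors of the preceding lemma each prescribe the sign at one
  zero of \<open>C\<close> and leave the other zeros alone, so composing \<open>C\<close> with them produces any sign vector
  above \<open>C\<close>.
\<close>

lemma uom_up_closed:
  assumes "finite B" "uom B K"
  shows "up_closed B (K - {\<lambda>_. 0})"
  unfolding up_closed_def
proof (intro ballI impI)
  fix W V assume W: "W \<in> K - {\<lambda>_. 0}" and V: "V \<in> sign_vectors B" and WV: "sle W V"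
  have com: "com B K" using assms(2) unfolding uom_def uom_of_rank_def om_def by blast
  have K: "K \<subseteq> sign_vectors B" using com unfolding com_def by blast
  obtain C where "C \<in> K" "C \<noteq> (\<lambda>_. 0)" "sle C W" "\<forall>Y\<in>K. Y \<noteq> (\<lambda>_. 0) \<and> sle Y C \<longrightarrow> Y = C"
    using exists_minimal_below[OF assms(1) K, of W "\<lambda>Y. Y \<noteq> (\<lambda>_. 0)"] W by blast
  then have C: "C \<in> cocircuits K" "C \<in> K" and CV: "sle C V"
    using sle_trans[OF _ WV] unfolding cocircuits_def by blast+
  have "(\<lambda>f. if f \<in> supp B C \<union> E then V f else 0) \<in> K" if "finite E" "E \<subseteq> B" for E
    using that
  proof (induction E rule: finite_induct)
    case empty
    have "(\<lambda>f. if f \<in> supp B C \<union> {} then V f else 0) = C"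
    proof
      fix f show "(if f \<in> supp B C \<union> {} then V f else 0) = C f"
        using CV sign_outside[OF subsetD[OF K C(2)], of f] unfolding sle_def supp_def by auto
    qed
    then show ?case using C(2) by simp
  next
    case (insert e E)
    let ?V = "\<lambda>E f. if f \<in> supp B C \<union> E then V f else 0"
    have IH: "?V E \<in> K" using insert.IH insert.prems by blast
    have e: "e \<in> B" using insert.prems by blast
    show ?case
    proof (cases "e \<in> supp B C \<or> V e = 0")
      case True
      then have "?V (insert e E) = ?V E" by (auto simp: fun_eq_iff)
      then show ?thesis using IH by simp
    next
      case False
      then have Ce: "C e = 0" using e unfolding supp_def by blast
      have "V e = 1 \<or> V e = -1" using False sign_cases[OF V, of e] by blast
      then obtain D where D: "D \<in> K" "D e = V e" "\<forall>f\<in>B. C f = 0 \<and> f \<noteq> e \<longrightarrow> D f = 0"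
        using uom_vector_crossing_one_element[OF assms C(1) e Ce] by blast
      have "scomp (?V E) D = ?V (insert e E)"
      proof
        fix f
        consider "f = e" | "f \<notin> B" | "f \<in> B" "C f = 0" "f \<noteq> e" | "C f \<noteq> 0" "f \<in> B" by blast
        then show "scomp (?V E) D f = ?V (insert e E) f"
        proof cases
          case 1
          then show ?thesis using D(2) by (simp add: scomp_def)
        next
          case 2
          then have "D f = 0" "V f = 0"
            using sign_outside[OF subsetD[OF K D(1)]] sign_outside[OF V] by simp_all
          then show ?thesis by (auto simp: scomp_def)
        next
          case 3
          then have "D f = 0" using D(3) by blast
          then show ?thesis using 3 by (simp add: scomp_def supp_def)
        next
          case 4
          then have "f \<in> supp B C" "V f = C f" using CV unfolding sle_def supp_def by auto
          then show ?thesis using 4 by (simp add: scomp_def)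
        qed
      qed
      then show ?thesis using com_scomp[OF com IH D(1)] by simp
    qed
  qed
  then have "(\<lambda>f. if f \<in> supp B C \<union> B then V f else 0) \<in> K" using assms(1) by blast
  moreover have "(\<lambda>f. if f \<in> supp B C \<union> B then V f else 0) = V"
    using sign_outside[OF V] by (auto simp: fun_eq_iff)
  ultimately have "V \<in> K" by simp
  moreover have "V \<noteq> (\<lambda>_. 0)" using W WV unfolding sle_def by auto
  ultimately show "V \<in> K - {\<lambda>_. 0}" by simp
qed

section \<open>Minimal covectors and their facets\<close>

definition minimal_covectors :: "'a svec set \<Rightarrow> 'a svec set" where
  "minimal_covectors L = {X \<in> L. \<forall>Y\<in>L. sle Y X \<longrightarrow> Y = X}"

lemma minimal_covectorsD: "X \<in> minimal_covectors L \<Longrightarrow> X \<in> L"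
  unfolding minimal_covectors_def by blast

lemma exists_minimal_covector_below:
  assumes "finite U" "L \<subseteq> sign_vectors U" "W \<in> L"
  obtains X where "X \<in> minimal_covectors L" "sle X W"
  using exists_minimal_below[OF assms, of "\<lambda>_. True"] unfolding minimal_covectors_def by blast

lemma face_eq_up_set:
  assumes "com U L" "X \<in> L"
  shows "face L X = {W \<in> L. sle X W}"
proof
  show "face L X \<subseteq> {W \<in> L. sle X W}"
    using com_scomp[OF assms] unfolding face_def by auto
  show "{W \<in> L. sle X W} \<subseteq> face L X"
  proof
    fix W assume "W \<in> {W \<in> L. sle X W}"
    then have "W = scomp X W" "W \<in> L" using sle_imp_scomp_eq[of X W] by auto
    then show "W \<in> face L X" unfolding face_def by blast
  qed
qed

lemma minimal_covector_facet:
  assumes "com U L" "X \<in> minimal_covectors L"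
  shows "facet L (face L X)"
proof -
  have X: "X \<in> L" using assms(2) by (rule minimal_covectorsD)
  have "face L Y = face L X" if Y: "Y \<in> L" "face L X \<subseteq> face L Y" for Y
  proof -
    have "X \<in> face L X" using face_eq_up_set[OF assms(1) X] X by simp
    then have "sle Y X" using Y face_eq_up_set[OF assms(1) Y(1)] by blast
    then show ?thesis using assms(2) Y(1) unfolding minimal_covectors_def by blast
  qed
  then show ?thesis using X unfolding facet_def by blast
qed

text \<open>
  Eliminating between \<open>X\<close> and \<open>Y\<close> gives a vector that still vanishes where \<open>X\<close> does and disagrees
  with \<open>X\<close> on fewer coordinates. When no disagreement is left, this vector lies below \<open>X\<close>, and it
  lies strictly below because it vanishes at an eliminated coordinate.
\<close>

lemma minimal_covector_unique_zero_set:
  assumes "L \<subseteq> sign_vectors U" "finite U" "sign_elim L" "X \<in> minimal_covectors L"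
    and "Y \<in> L" "\<And>f. X f = 0 \<Longrightarrow> Y f = 0"
  shows "Y = X"
  using assms(5,6)
proof (induction "card (separator U X Y)" arbitrary: Y rule: less_induct)
  case less
  have X: "X \<in> L" using assms(4) by (rule minimal_covectorsD)
  have Xv: "X \<in> sign_vectors U" and Yv: "Y \<in> sign_vectors U" using assms(1) X less.prems(1) by blast+
  show ?case
  proof (cases "separator U X Y = {}")
    case True
    have "Y f = 0 \<or> Y f = X f" for f
    proof (cases "f \<in> U")
      case True
      then have "X f * Y f \<noteq> -1" using \<open>separator U X Y = {}\<close> unfolding separator_def by blast
      then show ?thesis using sign_cases[OF Xv, of f] sign_cases[OF Yv, of f] less.prems(2)[of f] by auto
    next
      case False
      then show ?thesis using sign_outside[OF Yv] by simp
    qed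
    then have "sle Y X" unfolding sle_def by blast
    then show ?thesis using assms(4) less.prems(1) unfolding minimal_covectors_def by blast
  next
    case False
    then obtain e where e: "e \<in> separator U X Y" by blast
    then have eU: "e \<in> U" and es: "X e * Y e = -1" unfolding separator_def by simp_all
    obtain V where V: "V \<in> L" "V e = 0" "\<And>f. X f * Y f \<noteq> -1 \<Longrightarrow> V f = scomp X Y f"
      using sign_elimD[OF assms(3) X less.prems(1) es] by blast
    have VX: "V f = X f" if "X f * Y f \<noteq> -1" for f
      using V(3)[OF that] less.prems(2)[of f] by (auto simp: scomp_def)
    have V0: "V f = 0" if "X f = 0" for f using VX[of f] that by simp
    have "separator U X V \<subseteq> separator U X Y"
    proof
      fix f assume f: "f \<in> separator U X V"
      show "f \<in> separator U X Y"
      proof (rule ccontr)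
        assume "f \<notin> separator U X Y"
        then have "V f = X f" using f VX unfolding separator_def by simp
        then show False using f sign_cases[OF Xv, of f] unfolding separator_def by auto
      qed
    qed
    moreover have "e \<notin> separator U X V" using V(2) unfolding separator_def by simp
    ultimately have "separator U X V \<subset> separator U X Y" using e by blast
    then have "card (separator U X V) < card (separator U X Y)"
      using assms(2) by (intro psubset_card_mono) (auto simp: separator_def)
    then have "V = X" using less.hyps[OF _ V(1) V0] by blast
    then show ?thesis using V(2) es by simp
  qed
qed

text \<open>
  Seen from a facet with base \<open>X\<close>, every other covector \<open>Y\<close> thus has a proper trace \<open>X \<circ> Y\<close>.
  Gluing depends on this: the trace is not the base, hence it survives in the completed facet.
\<close>

lemma minimal_covector_scomp_neq:
  assumes "L \<subseteq> sign_vectors U" "finite U" "sign_elim L" "X \<in> minimal_covectors L"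
    and "Y \<in> L" "Y \<noteq> X"
  shows "scomp X Y \<noteq> X"
proof
  assume eq: "scomp X Y = X"
  have "Y f = 0" if "X f = 0" for f
    using fun_cong[OF eq, of f] that by (simp add: scomp_def)
  then show False using minimal_covector_unique_zero_set[OF assms(1-5)] assms(6) by blast
qed

lemma restrict_to_sign_vectors:
  "W \<in> sign_vectors U \<Longrightarrow> restrict_to (zero_set U X) W \<in> sign_vectors (zero_set U X)"
  unfolding sign_vectors_def restrict_to_def zero_set_eq by auto

lemma scomp_restrict_to:
  assumes "X \<in> sign_vectors U" "W \<in> sign_vectors U" "sle X W"
  shows "scomp X (restrict_to (zero_set U X) W) = W"
proof
  fix f
  show "scomp X (restrict_to (zero_set U X) W) f = W f"
    using assms(3) sign_outside[OF assms(2), of f]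
    unfolding scomp_def restrict_to_def zero_set_eq sle_def by auto
qed

lemma restrict_to_nonzero:
  assumes "X \<in> sign_vectors U" "W \<in> sign_vectors U" "sle X W" "W \<noteq> X"
  shows "restrict_to (zero_set U X) W \<noteq> (\<lambda>_. 0)"
proof
  assume "restrict_to (zero_set U X) W = (\<lambda>_. 0)"
  then have "scomp X (\<lambda>_. 0) = W" using scomp_restrict_to[OF assms(1-3)] by simp
  moreover have "scomp X (\<lambda>_. 0) = X" unfolding scomp_def by auto
  ultimately show False using assms(4) by simp
qed

lemma cuom_facet_up_closed:
  assumes "finite U" "cuom U L" "X \<in> minimal_covectors L"
    and "W \<in> L" "sle X W" "W \<noteq> X" "V \<in> sign_vectors U" "sle W V"
  shows "V \<in> L"
proof -
  let ?B = "zero_set U X"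
  let ?K = "restrict_to ?B ` face L X"
  have com: "com U L" using assms(2) unfolding cuom_def by blast
  have L: "L \<subseteq> sign_vectors U" using com unfolding com_def by blast
  have X: "X \<in> L" using assms(3) by (rule minimal_covectorsD)
  have Xv: "X \<in> sign_vectors U" and Wv: "W \<in> sign_vectors U" using L X assms(4) by blast+
  have "uom ?B ?K"
    using assms(2) X minimal_covector_facet[OF com assms(3)] unfolding cuom_def by blast
  moreover have "finite ?B" using assms(1) unfolding zero_set_eq by simp
  ultimately have up: "up_closed ?B (?K - {\<lambda>_. 0})" by (intro uom_up_closed)
  have "restrict_to ?B W \<noteq> (\<lambda>_. 0)"
    using restrict_to_nonzero[OF Xv Wv assms(5,6)] .
  moreover have "W \<in> face L X" using face_eq_up_set[OF com X] assms(4,5) by blast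
  ultimately have RW: "restrict_to ?B W \<in> ?K - {\<lambda>_. 0}" by blast
  have "sle (restrict_to ?B W) (restrict_to ?B V)"
    using assms(8) unfolding sle_def restrict_to_def by auto
  then have "restrict_to ?B V \<in> ?K"
    using up_closedD[OF up RW restrict_to_sign_vectors[OF assms(7)]] by blast
  then obtain V' where V': "V' \<in> L" "sle X V'" "restrict_to ?B V = restrict_to ?B V'"
    using face_eq_up_set[OF com X] by blast
  have "V = scomp X (restrict_to ?B V)"
    using scomp_restrict_to[OF Xv assms(7) sle_trans[OF assms(5,8)]] by simp
  also have "\<dots> = V'"
    unfolding V'(3) using scomp_restrict_to[OF Xv subsetD[OF L V'(1)] V'(2)] .
  finally show ?thesis using V'(1) by simp
qed

text \<open>
  The strict inequality pays for the additional zero that completing the facet creates.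
\<close>

lemma card_zero_set_less_vc_dim:
  assumes "finite U" "cuom U L" "X \<in> minimal_covectors L"
    and "W \<in> L" "sle X W" "W \<noteq> X"
  shows "card (zero_set U W) < vc_dim U (plus_set U ` topes U L)"
proof -
  have com: "com U L" using assms(2) unfolding cuom_def by blast
  have L: "L \<subseteq> sign_vectors U" using com unfolding com_def by blast
  have X: "X \<in> L" using assms(3) by (rule minimal_covectorsD)
  obtain e where e: "W e \<noteq> X e" using assms(6) by auto
  then have eX: "X e = 0" using assms(5) unfolding sle_def by metis
  have We: "W e = 1 \<or> W e = -1" using e eX sign_cases[OF subsetD[OF L assms(4)], of e] by auto
  then have eU: "e \<in> U" using sign_outside[OF subsetD[OF L assms(4)], of e] by fastforce
  \<comment> \<open>The mirror image of \<open>W\<close> in the facet has the same zero set and the other sign at \<open>e\<close>.\<close>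
  define W' where "W' = scomp X (- W)"
  have W'L: "W' \<in> L" unfolding W'_def using com_scomp_uminus[OF com X assms(4)] .
  have W'e: "W' e = - W e" using eX by (simp add: W'_def scomp_def)
  have W'0: "W' f = 0 \<longleftrightarrow> W f = 0" for f
    using assms(5) unfolding W'_def scomp_def sle_def by auto
  have XW': "sle X W'" unfolding W'_def by simp
  have W'X: "W' \<noteq> X" using W'e We eX by auto
  let ?A = "insert e (zero_set U W)"
  have "shattered U (plus_set U ` topes U L) ?A"
    unfolding shattered_def
  proof (intro conjI allI impI)
    show "?A \<subseteq> U" using eU unfolding zero_set_eq by blast
    fix Y assume Y: "Y \<subseteq> ?A"
    obtain Z where Z: "Z \<in> L" "sle X Z" "Z \<noteq> X" "\<And>f. Z f = 0 \<longleftrightarrow> W f = 0"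
      and Ze: "Z e = (if e \<in> Y then 1 else -1)"
    proof (cases "W e = (if e \<in> Y then 1 else -1)")
      case True
      then show ?thesis using that[of W] assms(4-6) by blast
    next
      case False
      then have "W' e = (if e \<in> Y then 1 else -1)" using W'e We by (auto split: if_splits)
      then show ?thesis using that[of W'] W'L XW' W'X W'0 by blast
    qed
    have Zv: "Z \<in> sign_vectors U" using L Z(1) by blast
    have "fill U Z Y \<in> L"
      using cuom_facet_up_closed[OF assms(1-3) Z(1-3) fill_sign_vectors[OF Zv] sle_fill[OF Zv]] .
    then have "fill U Z Y \<in> topes U L" by (rule fill_in_topes[OF Zv])
    moreover have same_zeros: "zero_set U W = zero_set U Z"
      using Z(4) unfolding zero_set_eq by blast
    have "(plus_set U Z \<union> (Y \<inter> zero_set U Z)) \<inter> ?A = Y"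
      using Y Ze eU unfolding same_zeros
      unfolding plus_set_def zero_set_eq by (auto split: if_splits)
    then have "plus_set U (fill U Z Y) \<inter> ?A = Y" by (simp only: plus_set_fill)
    ultimately show "\<exists>T\<in>plus_set U ` topes U L. T \<inter> ?A = Y" by blast
  qed
  then have "card ?A \<le> vc_dim U (plus_set U ` topes U L)"
    by (rule card_le_vc_dim[OF assms(1)])
  moreover have "e \<notin> zero_set U W" using We unfolding zero_set_eq by auto
  then have "card ?A = Suc (card (zero_set U W))"
    using assms(1) by (simp add: zero_set_eq)
  ultimately show ?thesis by simp
qed

text \<open>
  The completion is carried out on the zero set of \<open>X\<close> and carried back by composing with \<open>X\<close>, which
  fills in the constant coordinates of the facet.
\<close>

lemma cuom_facet_completion:
  assumes "finite U" "cuom U L" "X \<in> minimal_covectors L"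
  shows "\<exists>C. C \<subseteq> sign_vectors U \<and> C \<noteq> {} \<and> sign_elim C \<and> up_closed U C \<and>
    (\<forall>W\<in>C. sle X W \<and> card (zero_set U W) \<le> vc_dim U (plus_set U ` topes U L)) \<and>
    (\<forall>W\<in>L. sle X W \<and> W \<noteq> X \<longrightarrow> W \<in> C)"
proof -
  let ?B = "zero_set U X" and ?d = "vc_dim U (plus_set U ` topes U L)"
  let ?K = "restrict_to ?B ` face L X"
  have com: "com U L" using assms(2) unfolding cuom_def by blast
  have L: "L \<subseteq> sign_vectors U" using com unfolding com_def by blast
  have X: "X \<in> L" using assms(3) by (rule minimal_covectorsD)
  have Xv: "X \<in> sign_vectors U" using L X by blast
  have finB: "finite ?B" using assms(1) unfolding zero_set_eq by simp
  have uom: "uom ?B ?K"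
    using assms(2) X minimal_covector_facet[OF com assms(3)] unfolding cuom_def by blast
  then have comK: "com ?B ?K" unfolding uom_def uom_of_rank_def om_def by blast
  then have K: "?K \<subseteq> sign_vectors ?B" unfolding com_def by blast
  have small: "card (zero_set ?B V) < ?d" if V: "V \<in> ?K" "V \<noteq> (\<lambda>_. 0)" for V
  proof -
    obtain W where W: "W \<in> L" "sle X W" "V = restrict_to ?B W"
      using V(1) face_eq_up_set[OF com X] by blast
    have "restrict_to ?B X = (\<lambda>_. 0)"
      by (rule ext) (simp add: restrict_to_def zero_set_eq)
    then have "W \<noteq> X" using V(2) W(3) by blast
    then have "card (zero_set U W) < ?d"
      using card_zero_set_less_vc_dim[OF assms W(1,2)] by blast
    moreover have "zero_set ?B V = zero_set U W"
      using W(2,3) unfolding zero_set_eq restrict_to_def sle_def by auto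
    ultimately show ?thesis by simp
  qed
  obtain N where N: "N \<subseteq> sign_vectors ?B" "N \<noteq> {}" "?K - {\<lambda>_. 0} \<subseteq> N" "sign_elim N"
      "up_closed ?B N" "\<And>W. W \<in> N \<Longrightarrow> card (zero_set ?B W) \<le> ?d"
    using ample_completion[OF finB K com_sign_elim[OF comK] uom_up_closed[OF finB uom] small] by blast
  have restr: "restrict_to ?B (scomp X V) = V" if "V \<in> N" for V
  proof
    fix f show "restrict_to ?B (scomp X V) f = V f"
      using sign_outside[OF subsetD[OF N(1) that], of f]
      unfolding restrict_to_def scomp_def zero_set_eq by auto
  qed
  define C where "C = scomp X ` N"
  have "C \<subseteq> sign_vectors U"
    unfolding C_def
  proof (rule image_subsetI)
    fix V assume "V \<in> N"
    then have "V \<in> sign_vectors U"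
      using N(1) unfolding sign_vectors_def zero_set_eq by auto
    then show "scomp X V \<in> sign_vectors U" by (rule scomp_sign_vectors[OF Xv])
  qed
  moreover have "C \<noteq> {}" using N(2) unfolding C_def by simp
  moreover have "sign_elim C"
    unfolding sign_elim_def
  proof (intro ballI allI impI)
    fix Y1 Y2 e assume "Y1 \<in> C" "Y2 \<in> C" and e: "Y1 e * Y2 e = -1"
    then obtain V1 V2 where V: "V1 \<in> N" "V2 \<in> N" and Y: "Y1 = scomp X V1" "Y2 = scomp X V2"
      unfolding C_def by blast
    have Xe: "X e = 0" using e sign_cases[OF Xv, of e] Y by (auto simp: scomp_def)
    then have "V1 e * V2 e = -1" using e Y by (simp add: scomp_def)
    then obtain Z where Z: "Z \<in> N" "Z e = 0" "\<And>f. V1 f * V2 f \<noteq> -1 \<Longrightarrow> Z f = scomp V1 V2 f"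
      using sign_elimD[OF N(4) V] by blast
    have "scomp X Z f = scomp Y1 Y2 f" if "Y1 f * Y2 f \<noteq> -1" for f
      using Z(3)[of f] that Y by (auto simp: scomp_def)
    moreover have "scomp X Z e = 0" using Xe Z(2) by (simp add: scomp_def)
    ultimately show "\<exists>Z\<in>C. Z e = 0 \<and> (\<forall>f. Y1 f * Y2 f \<noteq> -1 \<longrightarrow> Z f = scomp Y1 Y2 f)"
      using Z(1) unfolding C_def by blast
  qed
  moreover have "up_closed U C"
    unfolding up_closed_def
  proof (intro ballI impI)
    fix W W' assume "W \<in> C" and W': "W' \<in> sign_vectors U" and le: "sle W W'"
    then obtain V where V: "V \<in> N" "W = scomp X V" unfolding C_def by blast
    have "sle V (restrict_to ?B W')"
      unfolding sle_def
    proof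
      fix f
      have "W f = 0 \<or> W f = W' f" using le unfolding sle_def by blast
      then show "V f = 0 \<or> V f = restrict_to ?B W' f"
        using fun_cong[OF restr[OF V(1)], of f] V(2) by (auto simp: restrict_to_def split: if_splits)
    qed
    then have "restrict_to ?B W' \<in> N"
      using up_closedD[OF N(5) V(1) restrict_to_sign_vectors[OF W']] by blast
    moreover have "W' = scomp X (restrict_to ?B W')"
      using scomp_restrict_to[OF Xv W'] sle_trans[OF _ le, of X] V(2) by simp
    ultimately show "W' \<in> C" unfolding C_def by blast
  qed
  moreover have "sle X W \<and> card (zero_set U W) \<le> ?d" if W: "W \<in> C" for W
  proof -
    obtain V where V: "V \<in> N" "W = scomp X V" using W unfolding C_def by blast
    have "zero_set U W = zero_set ?B V"
      using V(2) unfolding zero_set_eq scomp_def by auto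
    then show ?thesis using N(6)[OF V(1)] V(2) by simp
  qed
  moreover have "W \<in> C" if W: "W \<in> L" "sle X W" "W \<noteq> X" for W
  proof -
    have "restrict_to ?B W \<in> N"
      using N(3) restrict_to_nonzero[OF Xv subsetD[OF L W(1)] W(2,3)] face_eq_up_set[OF com X] W(1,2) by blast
    moreover have "W = scomp X (restrict_to ?B W)"
      using scomp_restrict_to[OF Xv subsetD[OF L W(1)] W(2)] by simp
    ultimately show ?thesis unfolding C_def by blast
  qed
  ultimately show ?thesis by blast
qed

section \<open>Gluing the completed facets\<close>

locale facet_completions =
  fixes U :: "'a set" and L :: "'a svec set" and C :: "'a svec \<Rightarrow> 'a svec set"
  assumes finite_U: "finite U"
    and com_L: "com U L"
    and C_sign_vectors: "X \<in> minimal_covectors L \<Longrightarrow> C X \<subseteq> sign_vectors U"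
    and C_above: "X \<in> minimal_covectors L \<Longrightarrow> W \<in> C X \<Longrightarrow> sle X W"
    and C_sign_elim: "X \<in> minimal_covectors L \<Longrightarrow> sign_elim (C X)"
    and C_up_closed: "X \<in> minimal_covectors L \<Longrightarrow> up_closed U (C X)"
    and C_contains: "X \<in> minimal_covectors L \<Longrightarrow> W \<in> L \<Longrightarrow> sle X W \<Longrightarrow> W \<noteq> X \<Longrightarrow> W \<in> C X"
begin

lemma L_sign_vectors: "L \<subseteq> sign_vectors U"
  using com_L unfolding com_def by blast

lemma L_sign_elim: "sign_elim L"
  using com_L by (rule com_sign_elim)

lemma C_scomp:
  assumes "X \<in> minimal_covectors L" "W \<in> L" "sle X W" "W \<noteq> X" "V \<in> sign_vectors U"
  shows "scomp W V \<in> C X"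
  using up_closedD[OF C_up_closed[OF assms(1)] C_contains[OF assms(1-4)]]
    scomp_sign_vectors[OF subsetD[OF L_sign_vectors assms(2)] assms(5)] by simp

text \<open>
  Within the facet of \<open>X\<close>, the vector \<open>X \<circ> X' \<circ> W'\<close> can stand in for \<open>W'\<close>: it agrees with \<open>W'\<close>
  wherever \<open>X\<close> vanishes, and with \<open>W\<close> everywhere else.
\<close>

lemma elim_where_base_vanishes:
  assumes X: "X \<in> minimal_covectors L" and X': "X' \<in> minimal_covectors L" and ne: "X \<noteq> X'"
    and W: "W \<in> C X" and W': "W' \<in> C X'" and e: "W e * W' e = -1" and Xe: "X e = 0"
  shows "\<exists>Z\<in>C X. Z e = 0 \<and> (\<forall>f. W f * W' f \<noteq> -1 \<longrightarrow> Z f = scomp W W' f)"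
proof -
  have XL: "X \<in> L" "X' \<in> L" using X X' by (simp_all add: minimal_covectorsD)
  have le: "sle X W" "sle X' W'" using C_above X X' W W' by blast+
  have Wv: "W \<in> sign_vectors U" and W'v: "W' \<in> sign_vectors U"
    using C_sign_vectors X X' W W' by blast+
  define V where "V = scomp (scomp X X') W'"
  have "scomp X X' \<noteq> X"
    using minimal_covector_scomp_neq[OF L_sign_vectors finite_U L_sign_elim X XL(2)] ne by blast
  then have V: "V \<in> C X"
    unfolding V_def by (intro C_scomp[OF X com_scomp[OF com_L XL] _ _ W'v]) simp_all
  have V_W': "V f = W' f" if "X f = 0" for f
    using le(2) that unfolding V_def scomp_def sle_def by metis
  have V_W: "V f = W f" if "X f \<noteq> 0" for f
    using le(1) that unfolding V_def scomp_def sle_def by metis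
  have "W e * V e = -1" using e V_W'[OF Xe] by simp
  then obtain Z where Z: "Z \<in> C X" "Z e = 0" "\<And>f. W f * V f \<noteq> -1 \<Longrightarrow> Z f = scomp W V f"
    using sign_elimD[OF C_sign_elim[OF X] W V] by blast
  have "Z f = scomp W W' f" if f: "W f * W' f \<noteq> -1" for f
  proof (cases "X f = 0")
    case True
    then show ?thesis using Z(3)[of f] f V_W'[OF True] by (simp add: scomp_def)
  next
    case False
    then have "W f \<noteq> 0" using le(1) unfolding sle_def by metis
    moreover have "W f * V f \<noteq> -1" using V_W[OF False] sign_cases[OF Wv, of f] by auto
    ultimately show ?thesis using Z(3)[of f] by (simp add: scomp_def)
  qed
  then show ?thesis using Z(1,2) by blast
qed

text \<open>
  Eliminating \<open>e\<close> between \<open>X\<close> and \<open>X'\<close> leads to a covector \<open>V\<close>, possibly in a third facet with base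
  \<open>Y\<close>. The sought vector cannot be taken directly above \<open>V\<close>, since \<open>V\<close> may equal \<open>Y\<close> and need not
  belong to the completed facet. But \<open>V \<circ> X\<close> and \<open>V \<circ> X'\<close> are different from \<open>Y\<close> and have opposite
  signs at \<open>e\<close>. Composing both with \<open>W \<circ> W'\<close> and eliminating \<open>e\<close> within the facet of \<open>Y\<close> gives the
  prescribed signs.
\<close>

lemma elim_where_bases_disagree:
  assumes X: "X \<in> minimal_covectors L" and X': "X' \<in> minimal_covectors L"
    and W: "W \<in> C X" and W': "W' \<in> C X'" and e: "X e * X' e = -1"
  shows "\<exists>Y\<in>minimal_covectors L. \<exists>Z\<in>C Y. Z e = 0 \<and> (\<forall>f. W f * W' f \<noteq> -1 \<longrightarrow> Z f = scomp W W' f)"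
proof -
  have XL: "X \<in> L" "X' \<in> L" using X X' by (simp_all add: minimal_covectorsD)
  have le: "sle X W" "sle X' W'" using C_above X X' W W' by blast+
  have Wv: "W \<in> sign_vectors U" and W'v: "W' \<in> sign_vectors U"
    using C_sign_vectors X X' W W' by blast+
  obtain V where V: "V \<in> L" "V e = 0" "\<And>f. X f * X' f \<noteq> -1 \<Longrightarrow> V f = scomp X X' f"
    using sign_elimD[OF L_sign_elim XL e] by blast
  obtain Y where Y: "Y \<in> minimal_covectors L" "sle Y V"
    using exists_minimal_covector_below[OF finite_U L_sign_vectors V(1)] by blast
  have Ye: "Y e = 0" using Y(2) V(2) unfolding sle_def by metis
  define T where "T = scomp W W'"
  have Tv: "T \<in> sign_vectors U" unfolding T_def using scomp_sign_vectors[OF Wv W'v] .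
  have Xe: "X e \<noteq> 0" "X' e \<noteq> 0" using e by auto
  have "scomp V R \<noteq> Y" if "R e \<noteq> 0" for R
  proof
    assume "scomp V R = Y"
    then have "scomp V R e = 0" using Ye by simp
    then show False using that V(2) by (simp add: scomp_def)
  qed
  then have in_C: "scomp (scomp V R) T \<in> C Y" if "R \<in> L" "R e \<noteq> 0" for R
    using that by (intro C_scomp[OF Y(1) com_scomp[OF com_L V(1)] sle_trans[OF Y(2) sle_scomp] _ Tv])
  have "scomp (scomp V X) T e * scomp (scomp V X') T e = -1"
    using e Xe V(2) by (simp add: scomp_def)
  then obtain Z where Z: "Z \<in> C Y" "Z e = 0"
    "\<And>f. scomp (scomp V X) T f * scomp (scomp V X') T f \<noteq> -1 \<Longrightarrow>
      Z f = scomp (scomp (scomp V X) T) (scomp (scomp V X') T) f"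
    using sign_elimD[OF C_sign_elim[OF Y(1)] in_C[OF XL(1) Xe(1)] in_C[OF XL(2) Xe(2)]] by blast
  have "Z f = T f" if f: "W f * W' f \<noteq> -1" for f
  proof -
    have XW: "X f = 0 \<or> W f = X f" and XW': "X' f = 0 \<or> W' f = X' f"
      using le unfolding sle_def by metis+
    have "X f * X' f \<noteq> -1" using f XW XW' by auto
    then have Vf: "V f = scomp X X' f" by (rule V(3))
    have VT: "V f = T f" if "V f \<noteq> 0"
      using that Vf f XW XW' sign_cases[OF Wv, of f] sign_cases[OF W'v, of f]
      unfolding T_def scomp_def by (auto split: if_splits)
    have X0: "X f = 0" "X' f = 0" if "V f = 0"
      using that Vf unfolding scomp_def by (auto split: if_splits)
    have eq: "scomp (scomp V X) T f = T f" "scomp (scomp V X') T f = T f"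
      using VT X0 by (auto simp: scomp_def)
    then have "scomp (scomp V X) T f * scomp (scomp V X') T f \<noteq> -1"
      using sign_cases[OF Tv, of f] by auto
    then show ?thesis using Z(3)[of f] eq by (simp add: scomp_def[of "scomp (scomp V X) T"])
  qed
  then show ?thesis using Y(1) Z(1,2) unfolding T_def by blast
qed

text \<open>
  If neither base vanishes at \<open>e\<close>, the bases have the signs of \<open>W\<close> and \<open>W'\<close> there and hence
  disagree, so the two preceding lemmas cover all cases.
\<close>

lemma sign_elim_union: "sign_elim (\<Union>X\<in>minimal_covectors L. C X)"
  unfolding sign_elim_def
proof (intro ballI allI impI)
  fix W W' e
  assume "W \<in> (\<Union>X\<in>minimal_covectors L. C X)" "W' \<in> (\<Union>X\<in>minimal_covectors L. C X)"
    and e: "W e * W' e = -1"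
  then obtain X X' where X: "X \<in> minimal_covectors L" "W \<in> C X"
    and X': "X' \<in> minimal_covectors L" "W' \<in> C X'" by blast
  have Wv: "W \<in> sign_vectors U" and W'v: "W' \<in> sign_vectors U"
    using C_sign_vectors X X' by blast+
  have le: "sle X W" "sle X' W'" using C_above X X' by blast+
  have "\<exists>Y\<in>minimal_covectors L. \<exists>Z\<in>C Y. Z e = 0 \<and>
      (\<forall>f. W f * W' f \<noteq> -1 \<longrightarrow> Z f = scomp W W' f)"
  proof (cases "X = X'")
    case True
    then have "W' \<in> C X" using X'(2) by simp
    then show ?thesis using C_sign_elim[OF X(1)] X e unfolding sign_elim_def by blast
  next
    case ne: False
    consider "X e = 0" | "X' e = 0" | "X e \<noteq> 0" "X' e \<noteq> 0" by blast
    then show ?thesis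
    proof cases
      case 1
      then show ?thesis using elim_where_base_vanishes[OF X(1) X'(1) ne X(2) X'(2) e] X(1) by blast
    next
      case 2
      have e': "W' e * W e = -1" using e by (simp add: mult.commute)
      obtain Z where Z: "Z \<in> C X'" "Z e = 0" "\<forall>f. W' f * W f \<noteq> -1 \<longrightarrow> Z f = scomp W' W f"
        using elim_where_base_vanishes[OF X'(1) X(1) not_sym[OF ne] X'(2) X(2) e' 2] by blast
      have "Z f = scomp W W' f" if f: "W f * W' f \<noteq> -1" for f
        using Z(3) f scomp_commute_off_separator[of W f W']
          sign_cases[OF Wv, of f] sign_cases[OF W'v, of f] by (simp add: mult.commute)
      then show ?thesis using Z(1,2) X'(1) by blast
    next
      case 3
      then have "X e * X' e = -1" using e le unfolding sle_def by metis
      then show ?thesis by (rule elim_where_bases_disagree[OF X(1) X'(1) X(2) X'(2)])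
    qed
  qed
  then show "\<exists>Z\<in>\<Union>X\<in>minimal_covectors L. C X. Z e = 0 \<and>
      (\<forall>f. W f * W' f \<noteq> -1 \<longrightarrow> Z f = scomp W W' f)" by blast
qed

end

section \<open>The ample completion\<close>

lemma ample_completion_of_cuom:
  assumes "finite U" "cuom U L" "L \<noteq> {}"
  shows "\<exists>S. S \<noteq> {} \<and> ample U S \<and> plus_set U ` topes U L \<subseteq> S \<and>
    vc_dim U S = vc_dim U (plus_set U ` topes U L)"
proof -
  let ?d = "vc_dim U (plus_set U ` topes U L)"
  have com: "com U L" using assms(2) unfolding cuom_def by blast
  have L: "L \<subseteq> sign_vectors U" using com unfolding com_def by blast
  define good where "good X C \<longleftrightarrow> C \<subseteq> sign_vectors U \<and> C \<noteq> {} \<and> sign_elim C \<and> up_closed U C \<and>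
    (\<forall>W\<in>C. sle X W \<and> card (zero_set U W) \<le> ?d) \<and>
    (\<forall>W\<in>L. sle X W \<and> W \<noteq> X \<longrightarrow> W \<in> C)" for X C
  have "\<forall>X\<in>minimal_covectors L. \<exists>C. good X C"
    unfolding good_def using cuom_facet_completion[OF assms(1,2)] by blast
  then obtain C where C: "\<And>X. X \<in> minimal_covectors L \<Longrightarrow> good X (C X)" by metis
  interpret facet_completions U L C
  proof
    show "finite U" "com U L" by fact+
    fix X assume "X \<in> minimal_covectors L"
    then have good: "good X (C X)" by (rule C)
    show "C X \<subseteq> sign_vectors U" "sign_elim (C X)" "up_closed U (C X)"
      using good unfolding good_def by blast+
    show "sle X W" if "W \<in> C X" for W
      using good that unfolding good_def by blast
    show "W \<in> C X" if "W \<in> L" "sle X W" "W \<noteq> X" for W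
      using good that unfolding good_def by blast
  qed
  define M where "M = (\<Union>X\<in>minimal_covectors L. C X)"
  define S where "S = plus_set U ` topes U M"
  have M_sub: "M \<subseteq> sign_vectors U" using C_sign_vectors unfolding M_def by blast
  have M_elim: "sign_elim M" unfolding M_def by (rule sign_elim_union)
  have M_up: "up_closed U M"
    using C_up_closed unfolding M_def up_closed_def by blast
  have C_ne: "C X \<noteq> {}" if "X \<in> minimal_covectors L" for X
    using C[OF that] unfolding good_def by blast
  have "topes U L \<subseteq> topes U M"
  proof
    fix T assume T: "T \<in> topes U L"
    then have TL: "T \<in> L" unfolding topes_def by blast
    obtain X where X: "X \<in> minimal_covectors L" "sle X T"
      using exists_minimal_covector_below[OF assms(1) L TL] by blast
    have "T \<in> C X"
    proof (cases "T = X")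
      case False
      then show ?thesis using C_contains[OF X(1) TL X(2)] by blast
    next
      case True
      \<comment> \<open>A tope that is itself minimal is the only sign vector above itself.\<close>
      obtain W where W: "W \<in> C X" using C_ne[OF X(1)] by blast
      have "sle T W" using C_above[OF X(1) W] True by simp
      moreover have "T f \<noteq> 0" if "f \<in> U" for f using T that unfolding topes_def by force
      moreover have "W f = T f" if "f \<notin> U" for f
        using sign_outside[OF subsetD[OF L TL] that]
          sign_outside[OF subsetD[OF C_sign_vectors[OF X(1)] W] that] by simp
      ultimately have "W = T" unfolding sle_def by (metis ext)
      then show ?thesis using W by simp
    qed
    then have "T \<in> M" using X(1) unfolding M_def by blast
    then show "T \<in> topes U M" using T unfolding topes_def by blast
  qed
  then have T_S: "plus_set U ` topes U L \<subseteq> S" unfolding S_def by blast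
  have "S \<noteq> {}"
  proof -
    obtain X where X: "X \<in> minimal_covectors L"
      using exists_minimal_covector_below[OF assms(1) L] assms(3) by blast
    obtain W where W: "W \<in> C X" using C_ne[OF X] by blast
    have Wv: "W \<in> sign_vectors U" using C_sign_vectors[OF X] W by blast
    have "W \<in> M" using W X unfolding M_def by blast
    then have "fill U W {} \<in> M" using up_closedD[OF M_up _ fill_sign_vectors[OF Wv] sle_fill[OF Wv]] by blast
    then have "fill U W {} \<in> topes U M" by (rule fill_in_topes[OF Wv])
    then show ?thesis unfolding S_def by blast
  qed
  moreover have "ample U S" unfolding S_def by (rule ample_topes[OF assms(1) M_sub M_elim M_up])
  moreover have "vc_dim U S \<le> ?d"
  proof (rule vc_dim_le)
    fix A assume "shattered U S A"
    then obtain Z where Z: "Z \<in> M" "A \<subseteq> zero_set U Z"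
      using shattered_by_topes_imp_zero[OF assms(1) M_elim] unfolding S_def by blast
    have "card (zero_set U Z) \<le> ?d" using Z(1) C unfolding M_def good_def by blast
    moreover have "card A \<le> card (zero_set U Z)"
      using Z(2) assms(1) by (intro card_mono) (auto simp: zero_set_eq)
    ultimately show "card A \<le> ?d" by simp
  qed
  ultimately show ?thesis
    using T_S vc_dim_mono[OF assms(1) T_S] by (intro exI[of _ S]) simp
qed

text \<open>
  Without covectors there are no topes, and the empty family is ample but not an ample partial
  cube. A single vertex then serves as the completion.
\<close>

lemma ample_completion_of_empty:
  "ample U {{}} \<and> vc_dim U {{}} = vc_dim U ({} :: 'a set set)"
proof
  have sh: "A = {}" if "shattered U {{}} A" for A
    using that unfolding shattered_def by auto
  then show "ample U {{}}" unfolding ample_def strongly_shattered_def by auto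
  have "vc_dim U {{}} \<le> 0"
  proof (rule vc_dim_le)
    show "card A \<le> 0" if "shattered U {{}} A" for A using sh[OF that] by simp
  qed
  moreover have "vc_dim U ({} :: 'a set set) \<le> 0"
    by (intro vc_dim_le) (auto simp: shattered_def)
  ultimately show "vc_dim U {{}} = vc_dim U ({} :: 'a set set)" by simp
qed

theorem theorem3:
  fixes U :: "'a set" and L :: "'a svec set" and G :: "'a cube_graph" and d :: nat
  assumes "finite U"
    and "simple_system U L"
    and "cuom U L"
    and "G = tope_graph U L"
    and "vc_dim U (verts G) = d"
  shows "\<exists>S. ample U S \<and> vc_dim U S = d \<and> plus_set U ` topes U L \<subseteq> S \<and>
           ample_partial_cube U (cube_subgraph S) \<and>
           verts G \<subseteq> verts (cube_subgraph S) \<and> edges G \<subseteq> edges (cube_subgraph S)"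
proof -
  have d: "vc_dim U (plus_set U ` topes U L) = d"
    using assms(4,5) by (simp add: tope_graph_def cube_subgraph_def)
  obtain S where S: "S \<noteq> {}" "ample U S" "plus_set U ` topes U L \<subseteq> S" "vc_dim U S = d"
  proof (cases "L = {}")
    case True
    then have "plus_set U ` topes U L = {}" unfolding topes_def by simp
    then show ?thesis using that[of "{{}}"] d ample_completion_of_empty[of U] by simp
  next
    case False
    then show ?thesis using that d ample_completion_of_cuom[OF assms(1,3)] by blast
  qed
  have "verts G \<subseteq> verts (cube_subgraph S)" "edges G \<subseteq> edges (cube_subgraph S)"
    using S(3) unfolding assms(4) tope_graph_def cube_subgraph_def by auto
  then show ?thesis using S unfolding ample_partial_cube_def by blast
qed

end
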